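(* Let $T\ge1$ and let $H(x,p)=\frac{|p|^2}{2}+V(x)$ for $(x,p)\in\mathbb T^d\times\mathbb R^d$, where $V\in C(\mathbb T^d)$ satisfies $\max_{x\in\mathbb T^d}V(x)=0$ and $V(x)\le-1$ for all $x\in B(0,\frac13)$. Suppose $G(m)\equiv0$ for all $m\in\mathcal P_2$. For $\varepsilon>0$ let $U^\varepsilon$ be the $L$-viscosity solution of $$-\partial_tU^\varepsilon+\int_{\mathbb R^d}H\big(\tfrac x\varepsilon,D_mU^\varepsilon(t,m,x)\big)m(dx)=0\ \text{ on }[0,T)\times\mathcal P_2,\qquad U^\varepsilon(T,\cdot)=G,$$ and let $U$ be the $L$-viscosity solution of $$-\partial_tU+\int_{\mathbb R^d}\overline H(D_mU(t,m,x))m(dx)=0\ \text{ on }[0,T)\times\mathcal P_2,\qquad U(T,\cdot)=G,$$ where $\overline H:\mathbb R^d\to\mathbb R$ is the effective Hamiltonian corresponding to $H$. Then $U^\varepsilon$ converges uniformly to $U\equiv0$ on $[0,T]\times\mathcal P_2$ as $\varepsilon\to0$, and for every $\varepsilon>0$ $$U^\varepsilon(T-1,\delta_0)\ge\frac\varepsilon6.$$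
   Context: $\mathbb T^d=\mathbb R^d/\mathbb Z^d$, and functions on $\mathbb T^d$ are identified with $\mathbb Z^d$-periodic functions on $\mathbb R^d$; $B(0,\frac13)$ is the ball of radius $\frac13$ centered at $0$. $\mathcal P_2$ is the set of Borel probability measures on $\mathbb R^d$ with finite second moment, with the 2-Wasserstein metric; $\delta_0$ is the Dirac mass at $0$; $\mathcal L(X)$ is the law of $X$; $D_m$ is the Wasserstein derivative. $\overline H(p)$ is the unique constant such that $H(y,p+D_yv(y))=\overline H(p)$, $y\in\mathbb T^d$, admits a continuous viscosity solution $v$ on $\mathbb T^d$. $L$-viscosity solutions: let $\mathcal H=L^2(\Omega;\mathbb R^d)$ over a non-atomic probability space and $\hat U(t,X)=U(t,\mathcal L(X))$, $\hat G(X)=G(\mathcal L(X))$. For an equation $-\partial_tU+\int F(x,D_mU)dm=0$, $U(T,\cdot)=G$, put $\hat F(X,P)=\mathbb E[F(X,P)]$. $U$ is an $L$-viscosity solution if $\hat U$ is continuous, $\hat U(T,\cdot)=\hat G$, and for every $\Phi\in C^{1,2}([0,T]\times\mathcal H)$ and $(t_0,X_0)\in[0,T)\times\mathcal H$ at which $\hat U-\Phi$ has a local maximum (resp. minimum), $-\partial_t\Phi(t_0,X_0)+\hat F(X_0,D\Phi(t_0,X_0))\le0$ (resp. $\ge0$). The solution $U^\varepsilon$ is the value function $$U^\varepsilon(t,m)=\inf\mathbb E\Big[\int_t^T\Big(\frac{|\alpha_s|^2}2-V\big(\tfrac{X_s}\varepsilon\big)\Big)ds\Big],\qquad X_s=X_t+\int_t^s\alpha_\tau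 d\tau,$$ the infimum being over $\mathbb F$-progressively measurable $\alpha:[t,T]\times\Omega\to\mathbb R^d$ with $\mathbb E\int_t^T|\alpha_s|^2ds<\infty$ and over $\mathcal F_t$-measurable $X_t$ with law $m$ independent of $B$, on an atomless filtered probability space $(\Omega,\mathcal F,\mathbb F=(\mathcal F_t)_{t\ge0},\mathbb P)$ carrying an $\mathbb F$-Brownian motion $B$ and an $\mathbb R^d$-valued Gaussian variable independent of $B$ and $\mathcal F_0$-measurable.
   Formalization: The lower bound U^ε(T−1,δ_0) ≥ ε/6 is stated for 0<ε≤6 instead of every ε>0: the control α=0 gives U^ε(T−1,δ_0) ≤ −V(0), and V(0)=−1 is allowed, so the bound fails for every ε>6. *)

theory Defs
  imports "HOL-Probability.Probability"
begin

section \<open>Periodic functions and viscosity solutions on the torus\<close>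

definition Zd_periodic :: "(real^'n \<Rightarrow> 'b) \<Rightarrow> bool" where
  "Zd_periodic f \<longleftrightarrow> (\<forall>x k. (\<forall>i. k $ i \<in> \<int>) \<longrightarrow> f (x + k) = f x)"

definition local_max_on :: "'a::topological_space set \<Rightarrow> ('a \<Rightarrow> real) \<Rightarrow> 'a \<Rightarrow> bool" where
  "local_max_on S f z \<longleftrightarrow> (\<forall>\<^sub>F w in at z within S. f w \<le> f z)"

definition local_min_on :: "'a::topological_space set \<Rightarrow> ('a \<Rightarrow> real) \<Rightarrow> 'a \<Rightarrow> bool" where
  "local_min_on S f z \<longleftrightarrow> (\<forall>\<^sub>F w in at z within S. f z \<le> f w)"

text \<open>Viscosity solutions of \<open>F(y, Dv(y)) = 0\<close>, tested with functions \<open>\<phi>\<close> of class \<open>C\<^sup>1\<close>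
  with gradient \<open>D\<close>.\<close>

definition viscosity_solution ::
    "(real^'n \<Rightarrow> real^'n \<Rightarrow> real) \<Rightarrow> (real^'n \<Rightarrow> real) \<Rightarrow> bool" where
  "viscosity_solution F v \<longleftrightarrow>
     (\<forall>\<phi> D y0. (\<forall>y. GDERIV \<phi> y :> D y) \<and> continuous_on UNIV D \<longrightarrow>
        (local_max_on UNIV (\<lambda>y. v y - \<phi> y) y0 \<longrightarrow> F y0 (D y0) \<le> 0) \<and>
        (local_min_on UNIV (\<lambda>y. v y - \<phi> y) y0 \<longrightarrow> F y0 (D y0) \<ge> 0))"

definition effective_hamiltonian ::
    "(real^'n \<Rightarrow> real^'n \<Rightarrow> real) \<Rightarrow> real^'n \<Rightarrow> real" where
  "effective_hamiltonian H p =
     (THE c. \<exists>v. Zd_periodic v \<and> continuous_on UNIV v \<and>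
                 viscosity_solution (\<lambda>y q. H y (p + q) - c) v)"


section \<open>Probability measures with finite second moment and the Hilbert space of lifts\<close>

definition P2 :: "(real^'n) measure set" where
  "P2 = {m. prob_space m \<and> sets m = sets borel \<and> integrable m (\<lambda>x. (norm x)\<^sup>2)}"

locale atomless_prob_space = prob_space +
  assumes atomless: "A \<in> sets M \<Longrightarrow> 0 < measure M A \<Longrightarrow>
    \<exists>A'\<in>sets M. A' \<subseteq> A \<and> 0 < measure M A' \<and> measure M A' < measure M A"

text \<open>HOL has no type of \<open>L\<^sup>2\<close> classes depending on a measure \<open>N\<close>. \<open>is_L2 N R\<close> says that the inner
  product space \<open>'h\<close> is \<open>L\<^sup>2(N; \<real>\<^sup>d)\<close>: \<open>R\<close> picks a representative of each element, the algebraic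
  operations and the inner product are the usual ones, and every square integrable function
  represents some element. Injectivity modulo null sets and completeness follow.\<close>

definition is_L2 :: "'a measure \<Rightarrow> ('h::real_inner \<Rightarrow> 'a \<Rightarrow> real^'n) \<Rightarrow> bool" where
  "is_L2 N R \<longleftrightarrow>
     (\<forall>X. R X \<in> borel_measurable N \<and> integrable N (\<lambda>\<omega>. (norm (R X \<omega>))\<^sup>2)) \<and>
     (\<forall>X Y. AE \<omega> in N. R (X + Y) \<omega> = R X \<omega> + R Y \<omega>) \<and>
     (\<forall>c X. AE \<omega> in N. R (c *\<^sub>R X) \<omega> = c *\<^sub>R R X \<omega>) \<and>
     (\<forall>X Y. inner X Y = (\<integral>\<omega>. inner (R X \<omega>) (R Y \<omega>) \<partial>N)) \<and>
     (\<forall>f\<in>borel_measurable N. integrable N (\<lambda>\<omega>. (norm (f \<omega>))\<^sup>2) \<longrightarrow>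
        (\<exists>X. AE \<omega> in N. R X \<omega> = f \<omega>))"


section \<open>L-viscosity solutions\<close>

text \<open>\<open>\<Phi>\<close> is of class \<open>C\<^sup>1\<^sup>,\<^sup>2\<close> on \<open>[0,T] \<times> 'h\<close>, with time derivative \<open>\<Phi>t\<close> (one-sided at the
  endpoints) and gradient \<open>D\<Phi>\<close>; \<open>D2\<close> is the Hessian, continuous in operator norm.\<close>

definition C12 :: "real \<Rightarrow> (real \<Rightarrow> 'h::real_inner \<Rightarrow> real) \<Rightarrow> (real \<Rightarrow> 'h \<Rightarrow> real) \<Rightarrow>
    (real \<Rightarrow> 'h \<Rightarrow> 'h) \<Rightarrow> bool" where
  "C12 T \<Phi> \<Phi>t D\<Phi> \<longleftrightarrow>
     (\<exists>D2 :: real \<Rightarrow> 'h \<Rightarrow> 'h \<Rightarrow>\<^sub>L 'h.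
        (\<forall>t\<in>{0..T}. \<forall>X.
           ((\<lambda>s. \<Phi> s X) has_real_derivative \<Phi>t t X) (at t within {0..T}) \<and>
           (GDERIV (\<Phi> t) X :> D\<Phi> t X) \<and>
           (D\<Phi> t has_derivative blinfun_apply (D2 t X)) (at X)) \<and>
        continuous_on ({0..T} \<times> UNIV) (\<lambda>(t, X). \<Phi> t X) \<and>
        continuous_on ({0..T} \<times> UNIV) (\<lambda>(t, X). \<Phi>t t X) \<and>
        continuous_on ({0..T} \<times> UNIV) (\<lambda>(t, X). D\<Phi> t X) \<and>
        continuous_on ({0..T} \<times> UNIV) (\<lambda>(t, X). D2 t X))"

text \<open>L-viscosity solutions of \<open>-\<partial>\<^sub>t U + \<integral> F(x, D\<^sub>m U) dm = 0\<close>, \<open>U(T,\<cdot>) = G\<close>; here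
  \<open>Uh\<close> and \<open>Fh\<close> are the lifts of \<open>U\<close> and \<open>F\<close>.\<close>

definition L_viscosity_solution :: "'a measure \<Rightarrow> ('h::real_inner \<Rightarrow> 'a \<Rightarrow> real^'n) \<Rightarrow> real \<Rightarrow>
    (real^'n \<Rightarrow> real^'n \<Rightarrow> real) \<Rightarrow> ((real^'n) measure \<Rightarrow> real) \<Rightarrow>
    (real \<Rightarrow> (real^'n) measure \<Rightarrow> real) \<Rightarrow> bool" where
  "L_viscosity_solution N R T F G U \<longleftrightarrow>
     (let Uh = (\<lambda>t X. U t (distr N borel (R X)));
          Fh = (\<lambda>X P. \<integral>\<omega>. F (R X \<omega>) (R P \<omega>) \<partial>N)
      in continuous_on ({0..T} \<times> UNIV) (\<lambda>(t, X). Uh t X) \<and>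
         (\<forall>X. Uh T X = G (distr N borel (R X))) \<and>
         (\<forall>\<Phi> \<Phi>t D\<Phi> t0 X0. C12 T \<Phi> \<Phi>t D\<Phi> \<and> t0 \<in> {0..<T} \<longrightarrow>
            (local_max_on ({0..T} \<times> UNIV) (\<lambda>(t, X). Uh t X - \<Phi> t X) (t0, X0) \<longrightarrow>
               - \<Phi>t t0 X0 + Fh X0 (D\<Phi> t0 X0) \<le> 0) \<and>
            (local_min_on ({0..T} \<times> UNIV) (\<lambda>(t, X). Uh t X - \<Phi> t X) (t0, X0) \<longrightarrow>
               - \<Phi>t t0 X0 + Fh X0 (D\<Phi> t0 X0) \<ge> 0)))"


section \<open>The control problem\<close>

text \<open>\<open>indep_var\<close> needs both variables to take values in one type, so independence of \<open>\<xi>\<close> from the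
  whole process \<open>(B\<^sub>s)\<^sub>s\<^sub>\<ge>\<^sub>0\<close> is stated for the generated sigma-algebras.\<close>

definition indep_of_process ::
    "'w measure \<Rightarrow> ('w \<Rightarrow> real^'n) \<Rightarrow> (real \<Rightarrow> 'w \<Rightarrow> real^'n) \<Rightarrow> bool" where
  "indep_of_process P \<xi> B \<longleftrightarrow>
     prob_space.indep_set P
       (sets (vimage_algebra (space P) \<xi> borel))
       (sets (vimage_algebra (space P) (\<lambda>\<omega>. \<lambda>s\<in>{0..}. B s \<omega>) (PiM {0..} (\<lambda>_. borel))))"

text \<open>Only times \<open>t \<ge> 0\<close> matter. Gaussian laws on \<open>\<real>\<^sup>d\<close> are described by their one-dimensional
  projections; note that the second parameter of \<^const>\<open>normal_density\<close> is the standard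
  deviation. The Gaussian variable \<open>Z\<close> is non-degenerate.\<close>

locale control_space = atomless_prob_space P
  for P :: "'w measure" +
  fixes F :: "real \<Rightarrow> 'w measure"
    and B :: "real \<Rightarrow> 'w \<Rightarrow> real^'n"
    and Z :: "'w \<Rightarrow> real^'n"
  assumes subalgebra_F: "0 \<le> t \<Longrightarrow> subalgebra P (F t)"
    and F_mono: "0 \<le> s \<Longrightarrow> s \<le> t \<Longrightarrow> sets (F s) \<subseteq> sets (F t)"
    and B_adapted: "0 \<le> t \<Longrightarrow> B t \<in> borel_measurable (F t)"
    and B_start: "AE \<omega> in P. B 0 \<omega> = 0"
    and B_continuous: "AE \<omega> in P. continuous_on {0..} (\<lambda>t. B t \<omega>)"
    and B_increment_indep: "0 \<le> s \<Longrightarrow> s < t \<Longrightarrow>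
          indep_set (sets (F s)) (sets (vimage_algebra (space P) (\<lambda>\<omega>. B t \<omega> - B s \<omega>) borel))"
    and B_increment_normal: "0 \<le> s \<Longrightarrow> s < t \<Longrightarrow> c \<noteq> 0 \<Longrightarrow>
          distributed P lborel (\<lambda>\<omega>. inner c (B t \<omega> - B s \<omega>))
            (normal_density 0 (norm c * sqrt (t - s)))"
    and Z_measurable: "Z \<in> borel_measurable (F 0)"
    and Z_normal: "c \<noteq> 0 \<Longrightarrow>
          \<exists>\<mu> \<sigma>. 0 < \<sigma> \<and> distributed P lborel (\<lambda>\<omega>. inner c (Z \<omega>)) (normal_density \<mu> \<sigma>)"
    and Z_indep: "indep_of_process P Z B"

definition prog_measurable_on ::
    "(real \<Rightarrow> 'w measure) \<Rightarrow> real \<Rightarrow> real \<Rightarrow> (real \<Rightarrow> 'w \<Rightarrow> real^'n) \<Rightarrow> bool" where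
  "prog_measurable_on F t T \<alpha> \<longleftrightarrow>
     (\<forall>s\<in>{t..T}. (\<lambda>(\<tau>, \<omega>). \<alpha> \<tau> \<omega>) \<in>
        borel_measurable (restrict_space borel {t..s} \<Otimes>\<^sub>M F s))"

definition admissible :: "'w measure \<Rightarrow> (real \<Rightarrow> 'w measure) \<Rightarrow> (real \<Rightarrow> 'w \<Rightarrow> real^'n) \<Rightarrow>
    real \<Rightarrow> real \<Rightarrow> (real^'n) measure \<Rightarrow> ((real \<Rightarrow> 'w \<Rightarrow> real^'n) \<times> ('w \<Rightarrow> real^'n)) set" where
  "admissible P F B T t m =
     {(\<alpha>, \<xi>). prog_measurable_on F t T \<alpha> \<and>
        (\<integral>\<^sup>+\<omega>. (\<integral>\<^sup>+s\<in>{t..T}. ennreal ((norm (\<alpha> s \<omega>))\<^sup>2) \<partial>lborel) \<partial>P) < \<infinity> \<and>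
        \<xi> \<in> borel_measurable (F t) \<and> distr P borel \<xi> = m \<and>
        indep_of_process P \<xi> B}"

definition trajectory ::
    "real \<Rightarrow> (real \<Rightarrow> 'w \<Rightarrow> real^'n) \<Rightarrow> ('w \<Rightarrow> real^'n) \<Rightarrow> real \<Rightarrow> 'w \<Rightarrow> real^'n" where
  "trajectory t \<alpha> \<xi> s \<omega> = \<xi> \<omega> + (LINT \<tau>:{t..s}|lborel. \<alpha> \<tau> \<omega>)"

definition value_function :: "'w measure \<Rightarrow> (real \<Rightarrow> 'w measure) \<Rightarrow>
    (real \<Rightarrow> 'w \<Rightarrow> real^'n) \<Rightarrow> (real^'n \<Rightarrow> real) \<Rightarrow> real \<Rightarrow> real \<Rightarrow> real \<Rightarrow>
    (real^'n) measure \<Rightarrow> real" where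
  "value_function P F B V T \<epsilon> t m =
     (INF (\<alpha>, \<xi>) \<in> admissible P F B T t m.
        \<integral>\<omega>. (LINT s:{t..T}|lborel.
               (norm (\<alpha> s \<omega>))\<^sup>2 / 2 - V (trajectory t \<alpha> \<xi> s \<omega> /\<^sub>R \<epsilon>)) \<partial>P)"

end

theory Submission
  imports Defs
begin

text \<open>
  The cell problem at \<open>p = 0\<close> is the eikonal equation \<open>|Dv|\<^sup>2 = -2V + 2c\<close>. Comparing \<open>v\<close> with
  constants at its minimum and with steep paraboloids near a zero of \<open>V\<close> forces \<open>c = 0\<close>, and then the
  distance to \<open>{V = 0}\<close> for the metric \<open>sqrt (-2V) |dx|\<close> is a solution. So \<open>0\<close> is the value of the
  effective Hamiltonian at \<open>0\<close>, and \<open>U = 0\<close> solves the limit equation.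

  The running cost is nonnegative and becomes zero once the state has reached a zero of \<open>V(\<cdot>/\<epsilon>)\<close>; such a
  zero is at distance \<open>O(\<epsilon>)\<close> and can be reached in time \<open>\<epsilon>\<close> at cost \<open>O(\<epsilon>)\<close>, uniformly in the initial
  law. Conversely, a path starting at the origin either stays in the ball of radius \<open>\<epsilon>/3\<close> during the
  whole unit of time, paying at least 1, or it leaves the ball, and by \<open>|\<alpha>| \<le> |\<alpha>|\<^sup>2/2 + 1\<close> it pays at
  least \<open>\<epsilon>/3\<close> before doing so.
\<close>

section \<open>The effective Hamiltonian at zero\<close>

text \<open>Integer translations bring every point into the unit cube, where compactness gives a
  minimum.\<close>

lemma Zd_periodic_attains_min:
  fixes v :: "real^'n \<Rightarrow> real"
  assumes per: "Zd_periodic v" and cont: "continuous_on UNIV v"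
  obtains y where "\<And>x. v y \<le> v x"
proof -
  have "0 \<in> cbox (0::real^'n) 1"
    by (simp add: mem_box_cart)
  then obtain y where y: "\<And>x. x \<in> cbox 0 1 \<Longrightarrow> v y \<le> v x"
    using continuous_attains_inf[OF compact_cbox, of "0::real^'n" 1 v]
      continuous_on_subset[OF cont subset_UNIV] by blast
  have "v y \<le> v x" for x
  proof -
    define k :: "real^'n" where "k = (\<chi> i. - of_int \<lfloor>x $ i\<rfloor>)"
    have "x $ i - of_int \<lfloor>x $ i\<rfloor> \<le> 1" for i
      by linarith
    then have "x + k \<in> cbox 0 1"
      by (simp add: mem_box_cart k_def)
    moreover have "v (x + k) = v x"
      using per by (simp add: Zd_periodic_def k_def)
    ultimately show ?thesis
      using y by metis
  qed
  then show thesis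
    using that by blast
qed

lemma Zd_periodic_bounded_below:
  fixes V :: "real^'n \<Rightarrow> real"
  assumes "Zd_periodic V" "continuous_on UNIV V"
  obtains C where "C > 0" "\<And>x. - C \<le> V x"
proof -
  obtain y where "\<And>x. V y \<le> V x"
    using Zd_periodic_attains_min[OF assms] by blast
  moreover have "- (\<bar>V y\<bar> + 1) \<le> V y"
    by linarith
  ultimately have "- (\<bar>V y\<bar> + 1) \<le> V x" for x
    by (meson order_trans)
  then show thesis
    by (intro that[of "\<bar>V y\<bar> + 1"]) auto
qed

section \<open>Polygonal paths and their weighted length\<close>

text \<open>Upper sums for the line integral of \<open>n\<close> along polygonal paths that start at
  a zero of \<open>n\<close>: each segment is charged its length times any bound \<open>M\<close> of
  \<open>n\<close> on it. Arguments about paths thus become inductions over segments, without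
  calculus along curves.\<close>

inductive travel_cost :: "('a::euclidean_space \<Rightarrow> real) \<Rightarrow> 'a \<Rightarrow> real \<Rightarrow> bool"
  for n :: "'a \<Rightarrow> real" where
  start: "n y = 0 \<Longrightarrow> travel_cost n y 0"
| move: "travel_cost n x c \<Longrightarrow> (\<And>z. z \<in> closed_segment x y \<Longrightarrow> n z \<le> M) \<Longrightarrow>
    travel_cost n y (c + M * norm (x - y))"

definition zero_distance :: "('a::euclidean_space \<Rightarrow> real) \<Rightarrow> 'a \<Rightarrow> real" where
  "zero_distance n y = Inf {c. travel_cost n y c}"

lemma travel_cost_periodic:
  fixes n :: "real^'n \<Rightarrow> real"
  assumes "travel_cost n y c" "Zd_periodic n" "\<forall>i. k $ i \<in> \<int>"
  shows "travel_cost n (y + k) c"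
  using assms(1)
proof induction
  case (start y)
  then show ?case
    using assms(2,3) by (intro travel_cost.start) (simp add: Zd_periodic_def)
next
  case (move x c y M)
  have "travel_cost n (y + k) (c + M * norm ((x + k) - (y + k)))"
  proof (rule travel_cost.move[OF move.IH])
    fix z
    assume "z \<in> closed_segment (x + k) (y + k)"
    then have "z \<in> (+) k ` closed_segment x y"
      by (simp add: closed_segment_translation add.commute)
    then obtain w where "w \<in> closed_segment x y" "z = w + k"
      by (auto simp: add.commute)
    then show "n z \<le> M"
      using move.hyps(2) assms(2,3) by (simp add: Zd_periodic_def)
  qed
  then show ?case
    by simp
qed

lemma Zd_periodic_zero_distance:
  fixes n :: "real^'n \<Rightarrow> real"
  assumes "Zd_periodic n"
  shows "Zd_periodic (zero_distance n)"
proof -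
  have "travel_cost n (x + k) c \<longleftrightarrow> travel_cost n x c" if "\<forall>i. k $ i \<in> \<int>" for x k c
  proof
    assume "travel_cost n (x + k) c"
    then have "travel_cost n (x + k + (- k)) c"
      by (rule travel_cost_periodic) (use that assms in auto)
    then show "travel_cost n x c"
      by simp
  next
    assume "travel_cost n x c"
    then show "travel_cost n (x + k) c"
      using that assms by (intro travel_cost_periodic)
  qed
  then show ?thesis
    by (auto simp: Zd_periodic_def zero_distance_def)
qed

lemma travel_cost_nonneg:
  assumes "travel_cost n y c" "\<And>x. 0 \<le> n x"
  shows "0 \<le> c"
  using assms(1)
proof induction
  case (move x c y M)
  then have "0 \<le> M"
    using assms(2) ends_in_segment(1) by (meson order_trans)
  with move show ?case
    by simp
qed simp

text \<open>A path reaching the ball crosses its sphere, and pays at least the rate \<open>\<kappa>\<close> from there on.\<close>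

lemma travel_cost_sphere:
  assumes "travel_cost n y c" "dist y y0 \<le> r" and "0 < \<kappa>"
    and \<kappa>: "\<And>z. dist z y0 \<le> r \<Longrightarrow> \<kappa> \<le> n z"
  shows "\<exists>z c'. dist z y0 = r \<and> travel_cost n z c' \<and> c' + \<kappa> * norm (z - y) \<le> c"
  using assms(1,2)
proof induction
  case (start y)
  \<comment> \<open>The starting point is a zero of \<open>n\<close>, but \<open>n\<close> is
    positive on the ball: this case is void.\<close>
  then show ?case
    using \<kappa>[of y] \<open>0 < \<kappa>\<close> by simp
next
  case (move x c y M)
  have M: "\<kappa> \<le> M"
    using \<kappa>[OF move.prems] move.hyps(2)[OF ends_in_segment(2)] by linarith
  \<comment> \<open>If the last segment starts inside the ball, the crossing found earlier still
    serves. Otherwise the crossing lies on that segment, which is cut there.\<close>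
  show ?case
  proof (cases "dist x y0 \<le> r")
    case True
    then obtain z c' where z: "dist z y0 = r" "travel_cost n z c'" "c' + \<kappa> * norm (z - x) \<le> c"
      using move.IH by blast
    have "\<kappa> * norm (z - y) \<le> \<kappa> * (norm (z - x) + norm (x - y))"
      using \<open>0 < \<kappa>\<close> norm_triangle_ineq[of "z - x" "x - y"] by simp
    also have "\<dots> \<le> \<kappa> * norm (z - x) + M * norm (x - y)"
      using M by (simp add: distrib_left mult_right_mono)
    finally show ?thesis
      using z by (intro exI[of _ z] exI[of _ c']) auto
  next
    case False
    have "continuous_on (closed_segment y x) (\<lambda>z. dist z y0)"
      by (intro continuous_intros)
    then have "connected ((\<lambda>z. dist z y0) ` closed_segment y x)"
      by (intro connected_continuous_image) auto
    then have "r \<in> (\<lambda>z. dist z y0) ` closed_segment y x"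
      using False move.prems connectedD_interval[of _ "dist y y0" "dist x y0" r] by auto
    then obtain z where z: "z \<in> closed_segment x y" "dist z y0 = r"
      by (auto simp: closed_segment_commute)
    have "travel_cost n z (c + M * norm (x - z))"
      using z(1) move.hyps(2) subset_closed_segment[of x z x y]
      by (intro travel_cost.move move.hyps(1)) auto
    moreover have "norm (x - y) = norm (x - z) + norm (z - y)"
      using z(1) between[of x y z] between_mem_segment[of x y z] by (simp add: dist_norm)
    then have "M * norm (x - z) + \<kappa> * norm (z - y) \<le> M * norm (x - y)"
      using M by (simp add: distrib_left mult_right_mono)
    ultimately show ?thesis
      using z(2) by (intro exI[of _ z] exI[of _ "c + M * norm (x - z)"]) auto
  qed
qed

section \<open>The weighted distance solves the eikonal equation\<close>

locale speed_bound =
  fixes n :: "'a::euclidean_space \<Rightarrow> real" and C :: real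
  assumes nonneg: "\<And>x. 0 \<le> n x" and bounded: "\<And>x. n x \<le> C" and zero: "\<exists>x. n x = 0"
    and cont: "continuous_on UNIV n"
begin

lemma travel_cost_ex: "\<exists>c. travel_cost n y c"
proof -
  obtain x where "n x = 0"
    using zero by blast
  then show ?thesis
    using travel_cost.move[OF travel_cost.start, of n x y C] bounded by blast
qed

lemma zero_distance_le: "travel_cost n y c \<Longrightarrow> zero_distance n y \<le> c"
  unfolding zero_distance_def
  using travel_cost_nonneg[OF _ nonneg] by (intro cInf_lower bdd_belowI[of _ 0]) auto

lemma zero_distance_ge:
  assumes "\<And>c. travel_cost n y c \<Longrightarrow> a \<le> c"
  shows "a \<le> zero_distance n y"
  unfolding zero_distance_def using travel_cost_ex assms by (intro cInf_greatest) auto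

text \<open>Any path to \<open>x\<close> can be prolonged by the segment to \<open>y\<close>. This
  gives both the Lipschitz bound and the subsolution property.\<close>

lemma zero_distance_step:
  assumes "\<And>z. z \<in> closed_segment x y \<Longrightarrow> n z \<le> M"
  shows "zero_distance n y \<le> zero_distance n x + M * norm (x - y)"
proof -
  have "zero_distance n y - M * norm (x - y) \<le> zero_distance n x"
  proof (rule zero_distance_ge)
    fix c
    assume "travel_cost n x c"
    then show "zero_distance n y - M * norm (x - y) \<le> c"
      using zero_distance_le[OF travel_cost.move[OF _ assms]] by fastforce
  qed
  then show ?thesis
    by simp
qed

lemma continuous_zero_distance: "continuous_on UNIV (zero_distance n)"
proof -
  have "\<bar>zero_distance n x - zero_distance n y\<bar> \<le> C * dist x y" for x y
    using zero_distance_step[of x y C] zero_distance_step[of y x C] bounded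
    by (simp add: dist_norm norm_minus_commute)
  then have "C-lipschitz_on UNIV (zero_distance n)"
    using order_trans[OF nonneg bounded] by (intro lipschitz_onI) (auto simp: dist_real_def)
  then show ?thesis
    by (rule lipschitz_on_continuous_on)
qed

lemma near:
  assumes "0 < e"
  obtains d where "0 < d" "\<And>z. dist z y0 < d \<Longrightarrow> \<bar>n z - n y0\<bar> < e"
  using cont assms unfolding continuous_on_iff by (metis UNIV_I dist_real_def)

text \<open>If \<open>norm D\<close> exceeded \<open>n y0\<close>, then \<open>\<phi>\<close> would
  fall along \<open>- D\<close> faster than the distance can: near \<open>y0\<close> the distance
  changes at a rate of at most \<open>M\<close>, with \<open>n y0 < M < norm D\<close>.\<close>

lemma zero_distance_subsolution:
  assumes D: "GDERIV \<phi> y0 :> D"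
    and max: "local_max_on UNIV (\<lambda>y. zero_distance n y - \<phi> y) y0"
  shows "norm D \<le> n y0"
proof (rule ccontr)
  assume "\<not> norm D \<le> n y0"
  then have less: "n y0 < norm D"
    by simp
  define M where "M = (n y0 + norm D) / 2"
  have M: "n y0 < M" "M < norm D"
    using less by (auto simp: M_def)
  obtain d where d: "0 < d" "\<And>z. dist z y0 < d \<Longrightarrow> \<bar>n z - n y0\<bar> < M - n y0"
    using near[of "M - n y0" y0] M by auto
  obtain d' where d': "0 < d'"
    "\<And>y. y \<noteq> y0 \<Longrightarrow> dist y y0 < d' \<Longrightarrow> zero_distance n y - \<phi> y \<le> zero_distance n y0 - \<phi> y0"
    using max unfolding local_max_on_def eventually_at by auto
  have D0: "0 < norm D"
    using less nonneg[of y0] by linarith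
  \<comment> \<open>The maximum and the step inequality force \<open>g 0 \<le> g h\<close> for small
    positive \<open>h\<close>, while the derivative of \<open>g\<close> at 0 is
    \<open>norm D * (M - norm D)\<close>, which is negative.\<close>
  define g where "g = (\<lambda>s. \<phi> (y0 - s *\<^sub>R D) + M * norm D * s)"
  have "(\<phi> has_derivative (\<lambda>h. inner h D)) (at y0)"
    using D by (simp add: gderiv_def)
  then have "((\<lambda>s. \<phi> (y0 - s *\<^sub>R D)) has_derivative (\<lambda>s. inner (- (s *\<^sub>R D)) D)) (at 0)"
    by (intro has_derivative_compose[where g = \<phi> and f = "\<lambda>s. y0 - s *\<^sub>R D"])
      (auto intro!: derivative_eq_intros)
  then have "((\<lambda>s. \<phi> (y0 - s *\<^sub>R D)) has_real_derivative - (norm D)\<^sup>2) (at 0)"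
    unfolding has_field_derivative_def
    by (rule has_derivative_eq_rhs) (auto simp: power2_norm_eq_inner)
  then have "(g has_real_derivative - (norm D)\<^sup>2 + M * norm D) (at 0)"
    unfolding g_def by (auto intro!: derivative_eq_intros)
  moreover have "- (norm D)\<^sup>2 + M * norm D < 0"
    using mult_strict_right_mono[OF M(2) D0] unfolding power2_eq_square by linarith
  ultimately obtain e where e: "0 < e" "\<And>h. 0 < h \<Longrightarrow> h < e \<Longrightarrow> g h < g 0"
    using DERIV_neg_dec_right[of g _ 0] by (metis add_0)
  define h where "h = min (e / 2) (min d d' / (2 * norm D))"
  have h: "0 < h" "h < e" "h * norm D < d" "h * norm D < d'"
  proof -
    show "0 < h" "h < e"
      using e d d' D0 by (auto simp: h_def)
    have "h * norm D \<le> min d d' / (2 * norm D) * norm D"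
      by (intro mult_right_mono) (auto simp: h_def)
    then have "h * norm D \<le> min d d' / 2"
      using D0 by (simp add: field_simps)
    then show "h * norm D < d" "h * norm D < d'"
      using d(1) d'(1) by auto
  qed
  define y where "y = y0 - h *\<^sub>R D"
  have dy: "norm (y - y0) = h * norm D"
    using h by (simp add: y_def)
  have "n z \<le> M" if "z \<in> closed_segment y y0" for z
  proof -
    have "dist z y0 \<le> dist y y0"
      using that segment_bound(2)[of z y y0]
      by (metis dist_commute dist_in_closed_segment)
    then show ?thesis
      using d(2)[of z] dy h by (simp add: dist_norm)
  qed
  then have "zero_distance n y0 \<le> zero_distance n y + M * (h * norm D)"
    using zero_distance_step[of y y0 M] dy by simp
  moreover have "zero_distance n y - \<phi> y \<le> zero_distance n y0 - \<phi> y0"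
    using d'(2)[of y] dy h D0 by (auto simp: dist_norm y_def)
  ultimately have "g 0 \<le> g h"
    by (simp add: g_def y_def algebra_simps)
  with e h show False
    by fastforce
qed

text \<open>Every path to \<open>y0\<close> crosses a small sphere around it and from there on pays
  at a rate above \<open>norm D\<close>, more than \<open>\<phi>\<close> can gain between the sphere
  and the centre.\<close>

lemma zero_distance_supersolution:
  assumes D: "GDERIV \<phi> y0 :> D"
    and min: "local_min_on UNIV (\<lambda>y. zero_distance n y - \<phi> y) y0"
  shows "n y0 \<le> norm D"
proof (rule ccontr)
  assume "\<not> n y0 \<le> norm D"
  then have less: "norm D < n y0"
    by simp
  \<comment> \<open>Of the gap \<open>3 * e\<close>, one \<open>e\<close> covers the variation of
    \<open>n\<close> on the ball and one the linearisation error of \<open>\<phi>\<close>; the third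
    remains as a gain.\<close>
  define e where "e = (n y0 - norm D) / 3"
  have e: "0 < e"
    using less by (simp add: e_def)
  obtain d where d: "0 < d" "\<And>z. dist z y0 < d \<Longrightarrow> \<bar>n z - n y0\<bar> < e"
    using near[OF e] by metis
  obtain d' where d': "0 < d'"
    "\<And>y. y \<noteq> y0 \<Longrightarrow> dist y y0 < d' \<Longrightarrow> zero_distance n y0 - \<phi> y0 \<le> zero_distance n y - \<phi> y"
    using min unfolding local_min_on_def eventually_at by auto
  obtain d'' where d'': "0 < d''"
    "\<And>y. norm (y - y0) < d'' \<Longrightarrow> norm (\<phi> y - \<phi> y0 - inner (y - y0) D) \<le> e * norm (y - y0)"
    using D e unfolding gderiv_def has_derivative_at_alt by blast
  define r where "r = min d (min d' d'') / 2"
  have r: "0 < r" "r < d" "r < d'" "r < d''"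
    using d d' d'' by (auto simp: r_def)
  have \<kappa>: "norm D + 2 * e \<le> n z" if "dist z y0 \<le> r" for z
  proof -
    have "n y0 - e < n z"
      using d(2)[of z] that r by linarith
    moreover have "n y0 = norm D + 3 * e"
      by (simp add: e_def field_simps)
    ultimately show ?thesis
      by linarith
  qed
  \<comment> \<open>The crossing point \<open>z\<close> depends on the path, but the gain
    \<open>e * r\<close> does not, so it survives the infimum over paths, which is absurd as
    \<open>e * r > 0\<close>.\<close>
  have "zero_distance n y0 + e * r \<le> zero_distance n y0"
  proof (rule zero_distance_ge)
    fix c
    assume "travel_cost n y0 c"
    moreover have "0 < norm D + 2 * e"
      using e norm_ge_zero[of D] by linarith
    ultimately obtain z c' where z: "dist z y0 = r" "travel_cost n z c'"
      "c' + (norm D + 2 * e) * norm (z - y0) \<le> c"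
      using travel_cost_sphere[of n y0 c y0 r "norm D + 2 * e"] \<kappa> r by auto
    have nz: "norm (z - y0) = r"
      using z by (simp add: dist_norm)
    have "zero_distance n y0 - \<phi> y0 \<le> zero_distance n z - \<phi> z"
      using d'(2)[of z] z r by fastforce
    moreover have "\<phi> y0 - \<phi> z \<le> e * r - inner (z - y0) D"
      using d''(2)[of z] nz r by simp
    moreover have "- inner (z - y0) D \<le> r * norm D"
      using Cauchy_Schwarz_ineq2[of "z - y0" D] nz by simp
    moreover have "zero_distance n z \<le> c'"
      using z by (rule_tac zero_distance_le)
    ultimately show "zero_distance n y0 + e * r \<le> c"
      using z(3) nz by (simp add: algebra_simps)
  qed
  then show False
    using mult_pos_pos[OF e r(1)] by linarith
qed

end

section \<open>The only possible critical value at zero momentum\<close>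

text \<open>A constant touches \<open>v\<close> from below at its minimum; the gradient is zero,
  which leaves \<open>c \<le> V y\<close>.\<close>

lemma viscosity_critical_value_nonpos:
  fixes V :: "real^'n \<Rightarrow> real"
  assumes V: "\<And>x. V x \<le> 0"
    and v: "Zd_periodic v" "continuous_on UNIV v"
      "viscosity_solution (\<lambda>y q. (norm q)\<^sup>2 / 2 + V y - c) v"
  shows "c \<le> 0"
proof -
  obtain y where y: "\<And>x. v y \<le> v x"
    using Zd_periodic_attains_min[OF v(1,2)] by blast
  have "local_min_on UNIV (\<lambda>y. v y - 0) y"
    using y by (simp add: local_min_on_def)
  then have "0 \<le> (norm (0::real^'n))\<^sup>2 / 2 + V y - c"
    using v(3)[unfolded viscosity_solution_def, rule_format, of "\<lambda>_. 0" "\<lambda>_. 0" y]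
    by (simp add: GDERIV_const)
  then show ?thesis
    using V[of y] by simp
qed

text \<open>A steep paraboloid centred at a zero of \<open>V\<close> touches \<open>v\<close> from above nearby.\<close>

lemma viscosity_critical_value_nonneg:
  fixes V :: "real^'n \<Rightarrow> real"
  assumes V: "continuous_on UNIV V" "V x0 = 0"
    and v: "continuous_on UNIV v"
      "viscosity_solution (\<lambda>y q. (norm q)\<^sup>2 / 2 + V y - c) v"
  shows "0 \<le> c"
proof (rule ccontr)
  assume "\<not> 0 \<le> c"
  then have "0 < - c"
    by simp
  then obtain r0 where r0: "0 < r0" "\<And>z. dist z x0 < r0 \<Longrightarrow> \<bar>V z\<bar> < - c"
    using V unfolding continuous_on_iff by (metis UNIV_I dist_real_def diff_zero)
  \<comment> \<open>Half the radius, so that the strict bound holds on the closed ball as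
    well.\<close>
  define r where "r = r0 / 2"
  have "c < V z" if "dist z x0 \<le> r" for z
  proof -
    have "dist z x0 < r0"
      using that r0(1) by (simp add: r_def)
    then show ?thesis
      using r0(2)[of z] by linarith
  qed
  then have r: "0 < r" "\<And>z. dist z x0 \<le> r \<Longrightarrow> c < V z"
    using r0(1) by (auto simp: r_def)
  have "compact (v ` cball x0 r)"
    by (intro compact_continuous_image continuous_on_subset[OF v(1)]) auto
  then obtain M where M: "\<And>z. z \<in> cball x0 r \<Longrightarrow> \<bar>v z\<bar> \<le> M"
    using compact_imp_bounded[of "v ` cball x0 r"] unfolding bounded_real by blast
  \<comment> \<open>On the sphere the paraboloid then equals \<open>2 * M + 1\<close>, more than the
    oscillation of \<open>v\<close> on the ball, so the maximum of \<open>v - \<phi>\<close> is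
    attained in the interior.\<close>
  define K where "K = (2 * M + 1) / r\<^sup>2"
  define \<phi> where "\<phi> = (\<lambda>y. K * inner (y - x0) (y - x0))"
  have "continuous_on (cball x0 r) (\<lambda>y. v y - \<phi> y)"
    unfolding \<phi>_def by (intro continuous_intros continuous_on_subset[OF v(1)]) auto
  then obtain y where y: "y \<in> cball x0 r" "\<And>z. z \<in> cball x0 r \<Longrightarrow> v z - \<phi> z \<le> v y - \<phi> y"
    using continuous_attains_sup[of "cball x0 r" "\<lambda>y. v y - \<phi> y"] r by auto
  have "dist y x0 < r"
  proof (rule ccontr)
    assume "\<not> dist y x0 < r"
    then have "norm (y - x0) = r"
      using y(1) by (simp add: dist_norm norm_minus_commute)
    then have "\<phi> y = 2 * M + 1"
      using r by (simp add: \<phi>_def K_def power2_norm_eq_inner[symmetric])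
    then show False
      using y(2)[of x0] M[of x0] M[OF y(1)] r by (simp add: \<phi>_def)
  qed
  then have "eventually (\<lambda>z. z \<in> ball x0 r) (nhds y)"
    by (intro eventually_nhds_in_open) (auto simp: dist_commute)
  then have "local_max_on UNIV (\<lambda>y. v y - \<phi> y) y"
    unfolding local_max_on_def eventually_at_filter
    by (rule eventually_mono) (use y(2) in auto)
  moreover have "GDERIV \<phi> z :> (2 * K) *\<^sub>R (z - x0)" for z
    unfolding \<phi>_def gderiv_def
    by (auto intro!: derivative_eq_intros simp: inner_commute algebra_simps)
  moreover have "continuous_on UNIV (\<lambda>z. (2 * K) *\<^sub>R (z - x0))"
    by (intro continuous_intros)
  ultimately have "(norm ((2 * K) *\<^sub>R (y - x0)))\<^sup>2 / 2 + V y - c \<le> 0"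
    using v(2)[unfolded viscosity_solution_def, rule_format, of \<phi> "\<lambda>z. (2 * K) *\<^sub>R (z - x0)" y]
    by simp
  then show False
    using r(2)[of y] y(1) by (smt (verit) dist_commute mem_cball zero_le_power2 divide_nonneg_pos)
qed

lemma effective_hamiltonian_zero:
  fixes V :: "real^'n \<Rightarrow> real"
  assumes V: "Zd_periodic V" "continuous_on UNIV V" "\<And>x. V x \<le> 0" "\<exists>x. V x = 0"
    and H: "\<And>x p. H x p = (norm p)\<^sup>2 / 2 + V x"
  shows "effective_hamiltonian H 0 = 0"
proof -
  \<comment> \<open>With this choice \<open>H y q \<le> 0\<close> means
    \<open>norm q \<le> n y\<close>, so the Hamilton-Jacobi inequalities become the eikonal
    ones.\<close>
  define n where "n = (\<lambda>x. sqrt (- 2 * V x))"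
  obtain C where C: "\<And>x. - C \<le> V x"
    using Zd_periodic_bounded_below[OF V(1,2)] by blast
  interpret speed_bound n "sqrt (2 * C)"
  proof
    show "n x \<le> sqrt (2 * C)" for x
      using C[of x] by (simp add: n_def)
    show "continuous_on UNIV n"
      unfolding n_def by (intro continuous_intros V)
  qed (use V in \<open>auto simp: n_def\<close>)
  have n2: "(n x)\<^sup>2 / 2 + V x = 0" for x
    using V(3)[of x] by (simp add: n_def)
  have "viscosity_solution (\<lambda>y q. H y (0 + q) - 0) (zero_distance n)"
    unfolding viscosity_solution_def
  proof (intro allI impI, elim conjE, intro conjI impI)
    fix \<phi> :: "real^'n \<Rightarrow> real" and D y0
    assume D: "\<forall>y. GDERIV \<phi> y :> D y"
    {
      assume "local_max_on UNIV (\<lambda>y. zero_distance n y - \<phi> y) y0"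
      then have "norm (D y0) \<le> n y0"
        using zero_distance_subsolution D by blast
      then show "H y0 (0 + D y0) - 0 \<le> 0"
        using n2[of y0] power_mono[of "norm (D y0)" "n y0" 2] by (simp add: H)
    next
      assume "local_min_on UNIV (\<lambda>y. zero_distance n y - \<phi> y) y0"
      then have "n y0 \<le> norm (D y0)"
        using zero_distance_supersolution D by blast
      then show "0 \<le> H y0 (0 + D y0) - 0"
        using n2[of y0] power_mono[OF _ nonneg, of y0 "norm (D y0)" 2] by (simp add: H)
    }
  qed
  moreover have "Zd_periodic (zero_distance n)"
    using V(1) by (intro Zd_periodic_zero_distance) (simp add: n_def Zd_periodic_def)
  \<comment> \<open>\<open>effective_hamiltonian\<close> is a definite description, so its value is
    determined only once the constant is known to be unique as well.\<close>
  moreover have "\<And>c v. Zd_periodic v \<and> continuous_on UNIV v \<and>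
      viscosity_solution (\<lambda>y q. H y (0 + q) - c) v \<Longrightarrow> c = 0"
  proof (elim conjE)
    fix c v
    assume v: "Zd_periodic v" "continuous_on UNIV v"
      and "viscosity_solution (\<lambda>y q. H y (0 + q) - c) v"
    then have vs: "viscosity_solution (\<lambda>y q. (norm q)\<^sup>2 / 2 + V y - c) v"
      by (simp add: H)
    obtain x0 where "V x0 = 0"
      using V(4) by blast
    then have "0 \<le> c"
      by (rule viscosity_critical_value_nonneg[OF V(2) _ v(2) vs])
    moreover have "c \<le> 0"
      by (rule viscosity_critical_value_nonpos[OF V(3) v vs])
    ultimately show "c = 0"
      by simp
  qed
  ultimately show ?thesis
    unfolding effective_hamiltonian_def using continuous_zero_distance
    by (intro the_equality exI[of _ "zero_distance n"]) auto
qed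

section \<open>The zero solution of the limit equation\<close>

text \<open>Since \<open>t0 < T\<close>, later times are available and give the sign of
  \<open>a\<close>; at \<open>t0 = 0\<close> there are no earlier ones, hence no equality in
  general. All directions in space are available, so the gradient vanishes.\<close>

lemma C1_local_min:
  fixes X0 :: "'h::real_inner"
  assumes t0: "t0 \<in> {0..<T}"
    and a: "((\<lambda>s. \<Phi> s X0) has_real_derivative a) (at t0 within {0..T})"
    and D: "GDERIV (\<Phi> t0) X0 :> D"
    and min: "local_min_on ({0..T} \<times> UNIV) (\<lambda>(t, X). \<Phi> t X) (t0, X0)"
  shows "0 \<le> a" "D = 0"
proof -
  obtain d where d: "0 < d" "\<And>t X. t \<in> {0..T} \<Longrightarrow> (t, X) \<noteq> (t0, X0) \<Longrightarrow> dist (t, X) (t0, X0) < d \<Longrightarrow>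
      \<Phi> t0 X0 \<le> \<Phi> t X"
    using min unfolding local_min_on_def eventually_at by auto
  show "0 \<le> a"
  proof (rule ccontr)
    assume "\<not> 0 \<le> a"
    then obtain e where e: "0 < e"
      "\<And>h. 0 < h \<Longrightarrow> t0 + h \<in> {0..T} \<Longrightarrow> h < e \<Longrightarrow> \<Phi> (t0 + h) X0 < \<Phi> t0 X0"
      using has_real_derivative_neg_dec_right[OF a] by force
    define h where "h = min (T - t0) (min d e / 2)"
    have h: "0 < h" "h \<le> T - t0" "h < d" "h < e"
      using t0 d(1) e(1) by (auto simp: h_def)
    have "\<Phi> t0 X0 \<le> \<Phi> (t0 + h) X0"
      using h t0 by (intro d(2)) (auto simp: dist_Pair_Pair dist_real_def)
    then show False
      using e(2)[of h] h t0 by auto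
  qed
  have "\<forall>\<^sub>F X in at X0. \<Phi> t0 X0 \<le> \<Phi> t0 X"
    unfolding eventually_at using d(1) t0
    by (intro exI[of _ d]) (auto intro!: d(2) simp: dist_Pair_Pair)
  then have "(\<lambda>h. inner h D) = (\<lambda>h. 0)"
    using D unfolding gderiv_def by (intro has_derivative_local_min)
  then have "inner D D = 0"
    by metis
  then show "D = 0"
    by simp
qed

lemma is_L2_distr_P2:
  assumes "prob_space N" "is_L2 N R"
  shows "distr N borel (R X) \<in> P2"
  using assms unfolding P2_def is_L2_def
  by (auto intro!: prob_space.prob_space_distr simp: integrable_distr_eq)

text \<open>A test function touching the zero function has zero gradient, so the Hamiltonian
  contributes \<open>h 0 = 0\<close>. The first-order condition in time, for \<open>\<Phi>\<close>
  at a maximum and for \<open>- \<Phi>\<close> at a minimum, gives the sign.\<close>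

lemma L_viscosity_solution_zero:
  fixes R :: "'h::real_inner \<Rightarrow> 'a \<Rightarrow> real^'n" and h :: "real^'n \<Rightarrow> real"
  assumes N: "prob_space N" "is_L2 N R" and h: "h 0 = 0" and G: "\<And>m. m \<in> P2 \<Longrightarrow> G m = 0"
  shows "L_viscosity_solution N R T (\<lambda>x p. h p) G (\<lambda>t m. 0)"
proof -
  \<comment> \<open>The representative of zero vanishes only almost everywhere; scaling by 0 shows
    this.\<close>
  have "AE \<omega> in N. R (0 *\<^sub>R 0) \<omega> = 0 *\<^sub>R R 0 \<omega>"
    using N(2) unfolding is_L2_def by blast
  then have R0: "AE \<omega> in N. h (R 0 \<omega>) = 0"
    by eventually_elim (simp add: h)
  \<comment> \<open>\<open>h \<circ> R 0\<close> need not be measurable; in that case its integral is 0 by convention.\<close>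
  have int: "(\<integral>\<omega>. h (R 0 \<omega>) \<partial>N) = 0"
    using R0 by (cases "integrable N (\<lambda>\<omega>. h (R 0 \<omega>))")
      (auto simp: not_integrable_integral_eq intro: integral_eq_zero_AE)
  have "- \<Phi>t t0 X0 + (\<integral>\<omega>. h (R (D\<Phi> t0 X0) \<omega>) \<partial>N) \<le> 0"
    if "C12 T \<Phi> \<Phi>t D\<Phi>" "t0 \<in> {0..<T}" "local_max_on ({0..T} \<times> UNIV) (\<lambda>(t, X). 0 - \<Phi> t X) (t0, X0)"
    for \<Phi> \<Phi>t D\<Phi> t0 X0
  proof -
    have der: "((\<lambda>s. \<Phi> s X0) has_real_derivative \<Phi>t t0 X0) (at t0 within {0..T})"
      "GDERIV (\<Phi> t0) X0 :> D\<Phi> t0 X0"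
      using that(1,2) by (auto simp: C12_def)
    have min: "local_min_on ({0..T} \<times> UNIV) (\<lambda>(t, X). \<Phi> t X) (t0, X0)"
      using that(3) by (simp add: local_min_on_def local_max_on_def case_prod_beta)
    show ?thesis
      using C1_local_min[OF that(2) der min] int by simp
  qed
  moreover have "0 \<le> - \<Phi>t t0 X0 + (\<integral>\<omega>. h (R (D\<Phi> t0 X0) \<omega>) \<partial>N)"
    if "C12 T \<Phi> \<Phi>t D\<Phi>" "t0 \<in> {0..<T}" "local_min_on ({0..T} \<times> UNIV) (\<lambda>(t, X). 0 - \<Phi> t X) (t0, X0)"
    for \<Phi> \<Phi>t D\<Phi> t0 X0
  proof -
    have der: "((\<lambda>s. - \<Phi> s X0) has_real_derivative - \<Phi>t t0 X0) (at t0 within {0..T})"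
      "GDERIV (\<lambda>X. - \<Phi> t0 X) X0 :> - D\<Phi> t0 X0"
      using that(1,2) by (auto simp: C12_def intro!: DERIV_minus GDERIV_minus)
    have min: "local_min_on ({0..T} \<times> UNIV) (\<lambda>(t, X). - \<Phi> t X) (t0, X0)"
      using that(3) by (simp add: local_min_on_def case_prod_beta)
    show ?thesis
      using C1_local_min[OF that(2) der min] int by simp
  qed
  ultimately show ?thesis
    using G is_L2_distr_P2[OF N] by (auto simp: L_viscosity_solution_def)
qed

section \<open>Random variables with a prescribed law\<close>

text \<open>Base 4 with digits 0 and 1: a sequence starting with 0 gives at most
  \<open>1/12\<close>, one starting with 1 at least \<open>1/4\<close>, so the leading digit can be
  read off. In base 2 two sequences can share a value.\<close>

definition bit_sum :: "(nat \<Rightarrow> bool) \<Rightarrow> real" where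
  "bit_sum b = (\<Sum>k. of_bool (b k) / 4 ^ Suc k)"

text \<open>On values of \<open>bit_sum\<close> this is the shift that drops \<open>k\<close>
  digits; the comparison with \<open>1/4\<close> reads the digit to be dropped.\<close>

fun bit_tail :: "nat \<Rightarrow> real \<Rightarrow> real" where
  "bit_tail 0 y = y"
| "bit_tail (Suc k) y = 4 * bit_tail k y - of_bool (1 / 4 \<le> bit_tail k y)"

lemma summable_bits: "summable (\<lambda>k. of_bool (b k) / 4 ^ Suc k :: real)"
proof (rule summable_comparison_test)
  show "\<exists>N. \<forall>k\<ge>N. norm (of_bool (b k) / 4 ^ Suc k :: real) \<le> (1 / 4) ^ Suc k"
    by (auto simp: power_divide divide_simps)
  show "summable (\<lambda>k. (1 / 4 :: real) ^ Suc k)"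
    by (subst summable_Suc_iff) (rule summable_geometric, simp)
qed

lemma bit_sum_Suc: "bit_sum b = (of_bool (b 0) + bit_sum (\<lambda>k. b (Suc k))) / 4"
proof -
  have "bit_sum b = of_bool (b 0) / 4 + (\<Sum>k. of_bool (b (Suc k)) / 4 ^ Suc (Suc k))"
    unfolding bit_sum_def using suminf_split_head[OF summable_bits[of b]] by simp
  also have "(\<Sum>k. of_bool (b (Suc k)) / 4 ^ Suc (Suc k) :: real)
      = (\<Sum>k. of_bool (b (Suc k)) / 4 ^ Suc k * (1 / 4))"
    by (intro arg_cong[where f = suminf] ext) simp
  also have "\<dots> = bit_sum (\<lambda>k. b (Suc k)) / 4"
    unfolding bit_sum_def using suminf_mult2[OF summable_bits[of "\<lambda>k. b (Suc k)"], of "1 / 4"] by simp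
  finally show ?thesis
    by simp
qed

lemma bit_sum_bounds: "0 \<le> bit_sum b" "bit_sum b \<le> 1 / 3"
proof -
  show "0 \<le> bit_sum b"
    unfolding bit_sum_def by (intro suminf_nonneg summable_bits) auto
  have "bit_sum b \<le> (\<Sum>k. of_bool True / 4 ^ Suc k)"
    unfolding bit_sum_def by (intro suminf_le summable_bits) (auto simp: divide_simps)
  also have "\<dots> = bit_sum (\<lambda>_. True)"
    by (simp add: bit_sum_def)
  \<comment> \<open>The all-ones value solves \<open>s = (1 + s) / 4\<close>.\<close>
  also have "\<dots> = 1 / 3"
    using bit_sum_Suc[of "\<lambda>_. True"] by simp
  finally show "bit_sum b \<le> 1 / 3" .
qed

lemma bit_sum_head: "1 / 4 \<le> bit_sum b \<longleftrightarrow> b 0"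
  using bit_sum_bounds[of "\<lambda>k. b (Suc k)"] by (subst bit_sum_Suc) auto

lemma bit_tail_bit_sum: "bit_tail k (bit_sum b) = bit_sum (\<lambda>j. b (k + j))"
proof (induction k)
  case (Suc k)
  have "bit_tail (Suc k) (bit_sum b)
      = 4 * bit_sum (\<lambda>j. b (k + j)) - of_bool (1 / 4 \<le> bit_sum (\<lambda>j. b (k + j)))"
    by (simp add: Suc)
  also have "\<dots> = 4 * bit_sum (\<lambda>j. b (k + j)) - of_bool (b k)"
    by (subst bit_sum_head) simp
  also have "\<dots> = bit_sum (\<lambda>j. b (Suc k + j))"
    using bit_sum_Suc[of "\<lambda>j. b (k + j)"] by simp
  finally show ?case .
qed simp

lemma measurable_bit_tail [measurable]: "bit_tail k \<in> borel_measurable borel"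
proof (induction k)
  case 0
  have "bit_tail 0 = (\<lambda>y. y)"
    by (simp add: fun_eq_iff)
  then show ?case
    by simp
next
  case (Suc k)
  note [measurable] = Suc
  have "bit_tail (Suc k) = (\<lambda>y. 4 * bit_tail k y - (if 1 / 4 \<le> bit_tail k y then 1 else 0))"
    by (simp add: fun_eq_iff)
  then show ?case
    by simp
qed

text \<open>A countable supremum, hence suitable for measurability; in \<open>ereal\<close> the
  value \<open>-\<infinity>\<close> makes the excluded rationals harmless.\<close>

lemma SUP_rat_le: "(SUP q. if real_of_rat q \<le> x then ereal (of_rat q) else -\<infinity>) = ereal x"
proof (rule antisym)
  show "(SUP q. if real_of_rat q \<le> x then ereal (of_rat q) else -\<infinity>) \<le> ereal x"
    by (intro SUP_least) auto
  show "ereal x \<le> (SUP q. if real_of_rat q \<le> x then ereal (of_rat q) else -\<infinity>)"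
  proof (rule dense_le)
    fix y
    assume "y < ereal x"
    then obtain z where z: "y < ereal z" "z < x"
      using ereal_dense2 by force
    then obtain q where q: "z < of_rat q" "of_rat q < x"
      using of_rat_dense by blast
    have "y \<le> ereal (of_rat q)"
      using z q by (metis ereal_less_eq(3) less_imp_le order_trans)
    also have "\<dots> = (if real_of_rat q \<le> x then ereal (of_rat q) else -\<infinity>)"
      using q by simp
    also have "\<dots> \<le> (SUP q. if real_of_rat q \<le> x then ereal (of_rat q) else -\<infinity>)"
      by (rule SUP_upper) simp
    finally show "y \<le> (SUP q. if real_of_rat q \<le> x then ereal (of_rat q) else -\<infinity>)" .
  qed
qed

text \<open>A point \<open>x\<close> is determined by the bits deciding \<open>q \<le> x\<^sub>i\<close> for all \<open>i\<close> and rational \<open>q\<close>; these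
  are the digits in base 4 of \<open>code x\<close>.\<close>

lemma borel_code_real:
  obtains code :: "real^'n \<Rightarrow> real" and decode :: "real \<Rightarrow> real^'n"
  where "code \<in> borel_measurable borel" "decode \<in> borel_measurable borel" "\<And>x. decode (code x) = x"
proof
  define idx where "idx k = (from_nat k :: 'n \<times> rat)" for k
  define bit where "bit x k \<longleftrightarrow> real_of_rat (snd (idx k)) \<le> x $ fst (idx k)" for x :: "real^'n" and k
  \<comment> \<open>The \<open>k\<close>-th digit tells whether a certain rational is at most a
    certain coordinate. A positive answer about coordinate \<open>i\<close> counts as a lower bound,
    anything else as \<open>-\<infinity>\<close>; the supremum over \<open>k\<close> recovers the
    coordinate.\<close>
  define val where "val i y k = (if fst (idx k) = i \<and> 1 / 4 \<le> bit_tail k y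
      then ereal (of_rat (snd (idx k))) else -\<infinity>)" for i y k
  let ?code = "\<lambda>x. bit_sum (bit x)" and ?decode = "\<lambda>y. \<chi> i. real_of_ereal (SUP k. val i y k)"
  have [measurable]: "(\<lambda>x::real^'n. x $ i) \<in> borel_measurable borel" for i
    by (intro borel_measurable_continuous_onI continuous_intros)
  show "?code \<in> borel_measurable borel"
    unfolding bit_sum_def bit_def of_bool_def by measurable
  have "(\<lambda>y. val i y k) \<in> borel_measurable borel" for i k
    unfolding val_def by measurable
  then have "(\<lambda>y. real_of_ereal (SUP k. val i y k)) \<in> borel_measurable borel" for i
    by measurable
  then show "?decode \<in> borel_measurable borel"
    by (subst borel_measurable_euclidean_space) (auto simp: Basis_vec_def inner_axis)
  fix x
  have "(SUP k. val i (?code x) k) = ereal (x $ i)" for i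
  proof -
    have val: "val i (?code x) k = (if fst (idx k) = i \<and> real_of_rat (snd (idx k)) \<le> x $ i
        then ereal (of_rat (snd (idx k))) else -\<infinity>)" for k
      unfolding val_def bit_tail_bit_sum bit_sum_head by (auto simp: bit_def)
    have "(SUP k. val i (?code x) k) = (SUP q. if real_of_rat q \<le> x $ i then ereal (of_rat q) else -\<infinity>)"
    proof (intro antisym SUP_least)
      fix k
      show "val i (?code x) k \<le> (SUP q. if real_of_rat q \<le> x $ i then ereal (of_rat q) else -\<infinity>)"
        unfolding val by (intro SUP_upper2[of "snd (idx k)"]) auto
    next
      fix q
      have "idx (to_nat (i, q)) = (i, q)"
        by (simp add: idx_def)
      then show "(if real_of_rat q \<le> x $ i then ereal (of_rat q) else -\<infinity>) \<le> (SUP k. val i (?code x) k)"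
        unfolding val by (intro SUP_upper2[of "to_nat (i, q)"]) auto
    qed
    then show ?thesis
      by (simp only: SUP_rat_le)
  qed
  then show "?decode (?code x) = x"
    by (simp add: vec_eq_iff)
qed

section \<open>Transport of atomless laws\<close>

text \<open>The map is the quantile function of \<open>\<mu>\<close> after the distribution function
  of \<open>\<nu>\<close>: without atoms the latter is uniformly distributed under
  \<open>\<nu>\<close>, and quantiles turn the uniform law into \<open>\<mu>\<close>.\<close>

lemma transport_real:
  assumes "real_distribution \<nu>" and atomless: "\<And>x. measure \<nu> {x} = 0" and "real_distribution \<mu>"
  obtains f where "f \<in> borel_measurable borel" "distr \<nu> borel f = \<mu>"
proof
  interpret \<nu>: cdf_distribution \<nu>
    unfolding cdf_distribution_def by fact
  interpret \<mu>: cdf_distribution \<mu>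
    unfolding cdf_distribution_def by fact
  let ?\<Omega> = "restrict_space lborel {0<..<1::real}"
  \<comment> \<open>The distribution function may take the values 0 and 1, outside the range of
    levels for quantiles; \<open>q\<close> is set to 0 there.\<close>
  define q where "q y = (if y \<in> {0<..<1} then \<mu>.I y else 0)" for y
  have q [measurable]: "q \<in> borel_measurable borel"
    unfolding q_def using measurable_restrict_space_iff[of "{0<..<1::real}" borel 0 borel \<mu>.I] \<mu>.measurable_CI by simp
  have \<Omega>: "measurable ?\<Omega> N = measurable (restrict_space borel {0<..<1}) N" for N :: "real measure"
    by (intro measurable_cong_sets sets_restrict_space_cong) auto
  \<comment> \<open>For a general law only \<open>u \<le> \<nu>.C (\<nu>.I u)\<close> holds;
    equality comes from continuity of the distribution function, that is, the absence of
    atoms.\<close>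
  have CI: "\<nu>.C (\<nu>.I u) = u" if u: "u \<in> {0<..<1}" for u
  proof (rule antisym)
    have "isCont \<nu>.C (\<nu>.I u)"
      using atomless \<nu>.isCont_cdf by blast
    then have "(\<nu>.C \<longlongrightarrow> \<nu>.C (\<nu>.I u)) (at_left (\<nu>.I u))"
      unfolding isCont_def by (rule filterlim_mono) (auto intro: at_le)
    moreover have "\<nu>.C x \<le> u" if "x < \<nu>.I u" for x
      using \<nu>.pseudoinverse'[rule_format, OF u, of x] that by linarith
    then have "eventually (\<lambda>x. \<nu>.C x \<le> u) (at_left (\<nu>.I u))"
      by (auto simp: eventually_at_filter)
    ultimately show "\<nu>.C (\<nu>.I u) \<le> u"
      by (rule tendsto_upperbound) simp
    show "u \<le> \<nu>.C (\<nu>.I u)"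
      using \<nu>.pseudoinverse'[rule_format, OF u] by blast
  qed
  show "(\<lambda>x. q (\<nu>.C x)) \<in> borel_measurable borel"
    by measurable
  have I: "\<nu>.I \<in> borel_measurable ?\<Omega>" "\<mu>.I \<in> borel_measurable ?\<Omega>"
    using \<nu>.measurable_CI \<mu>.measurable_CI by (simp_all add: \<Omega>)
  \<comment> \<open>\<open>\<nu>\<close> is itself the image of the uniform law under its quantile
    function, so the composition collapses by \<open>CI\<close>.\<close>
  have "distr \<nu> borel (\<lambda>x. q (\<nu>.C x)) = distr (distr ?\<Omega> borel \<nu>.I) borel (\<lambda>x. q (\<nu>.C x))"
    by (simp only: \<nu>.distr_I_eq_M)
  also have "\<dots> = distr ?\<Omega> borel (\<lambda>u. q (\<nu>.C (\<nu>.I u)))"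
    using I by (subst distr_distr) (auto simp: comp_def)
  also have "\<dots> = distr ?\<Omega> borel \<mu>.I"
    by (intro distr_cong) (auto simp: space_restrict_space CI q_def)
  finally show "distr \<nu> borel (\<lambda>x. q (\<nu>.C x)) = \<mu>"
    by (simp only: \<mu>.distr_I_eq_M)
qed

text \<open>\<open>code\<close> moves \<open>m\<close> to the line, where a transport exists, and
  \<open>decode\<close> moves it back.\<close>

lemma transport_vec:
  fixes m :: "(real^'n) measure"
  assumes \<nu>: "real_distribution \<nu>" "\<And>x. measure \<nu> {x} = 0"
    and m: "prob_space m" "sets m = sets borel"
  obtains f where "f \<in> borel_measurable borel" "distr \<nu> borel f = m"
proof -
  interpret m: prob_space m by fact
  interpret \<nu>: real_distribution \<nu> by fact
  obtain code :: "real^'n \<Rightarrow> real" and decode where code [measurable]: "code \<in> borel_measurable borel"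
    and decode [measurable]: "decode \<in> borel_measurable borel" and inv: "\<And>x. decode (code x) = x"
    using borel_code_real by blast
  have code_m: "code \<in> borel_measurable m"
    using code by (simp only: measurable_cong_sets[OF m(2) refl])
  obtain g where g [measurable]: "g \<in> borel_measurable borel" and "distr \<nu> borel g = distr m borel code"
    using transport_real[OF \<nu> m.real_distribution_distr[OF code_m]] by metis
  then have "distr (distr \<nu> borel g) borel decode = distr m borel (decode \<circ> code)"
    using code_m by (simp add: distr_distr)
  also have "\<dots> = m"
    using m(2) by (simp add: comp_def inv distr_id2)
  finally have "distr \<nu> borel (decode \<circ> g) = m"
    by (simp add: distr_distr)
  then show thesis
    by (intro that[of "decode \<circ> g"]) auto
qed

context control_space
begin

text \<open>The Gaussian variable supplies the randomness: one coordinate of \<open>Z\<close> has a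
  density, so a function of it can have any law \<open>m\<close>. Being a function of
  \<open>Z\<close>, it is known at time 0 and independent of \<open>B\<close>.\<close>

lemma initial_condition_ex:
  fixes m :: "(real^'n) measure"
  assumes m: "prob_space m" "sets m = sets borel" and t: "0 \<le> t"
  obtains \<xi> where "\<xi> \<in> borel_measurable (F t)" "distr P borel \<xi> = m" "indep_of_process P \<xi> B"
proof -
  define c where "c = (axis undefined 1 :: real^'n)"
  have c: "c \<noteq> 0"
    by (simp add: c_def axis_eq_0_iff)
  have "subalgebra P (F 0)"
    by (rule subalgebra_F) simp
  then have ZP [measurable]: "Z \<in> borel_measurable P"
    using measurable_from_subalg Z_measurable by blast
  obtain \<mu> \<sigma> where "distributed P lborel (\<lambda>\<omega>. inner c (Z \<omega>)) (normal_density \<mu> \<sigma>)"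
    using Z_normal[OF c] by blast
  then have dens: "distr P lborel (\<lambda>\<omega>. inner c (Z \<omega>)) = density lborel (\<lambda>x. ennreal (normal_density \<mu> \<sigma> x))"
    by (simp add: distributed_def)
  define \<nu> where "\<nu> = distr P borel (\<lambda>\<omega>. inner c (Z \<omega>))"
  have \<nu>: "real_distribution \<nu>"
    unfolding \<nu>_def by (intro real_distribution_distr) simp
  have "\<nu> = density lborel (\<lambda>x. ennreal (normal_density \<mu> \<sigma> x))"
    unfolding \<nu>_def dens[symmetric] by (intro distr_cong) auto
  then have "absolutely_continuous lborel \<nu>"
    by (simp add: absolutely_continuousI_density)
  moreover have "{x} \<in> null_sets lborel" for x :: real
    by (simp add: null_sets_def)
  ultimately have "{x} \<in> null_sets \<nu>" for x
    unfolding absolutely_continuous_def by blast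
  then have "measure \<nu> {x} = 0" for x
    by (simp add: measure_eq_0_null_sets)
  then obtain f where f [measurable]: "f \<in> borel_measurable borel" and fm: "distr \<nu> borel f = m"
    using transport_vec[OF \<nu> _ m] by metis
  define h where "h z = f (inner c z)" for z
  have h [measurable]: "h \<in> borel_measurable borel"
    unfolding h_def by measurable
  define \<xi> where "\<xi> \<omega> = h (Z \<omega>)" for \<omega>
  have "\<xi> \<in> borel_measurable (F 0)"
    unfolding \<xi>_def using Z_measurable by measurable
  moreover have "space (F s) = space P" if "0 \<le> s" for s
    using subalgebra_F[OF that] by (simp add: subalgebra_def)
  ultimately have "\<xi> \<in> borel_measurable (F t)"
    using F_mono[of 0 t] t by (intro measurable_from_subalg[of "F t" "F 0"]) (auto simp: subalgebra_def)
  moreover have "distr P borel \<xi> = m"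
    unfolding fm[symmetric] \<nu>_def \<xi>_def h_def by (subst distr_distr) (auto simp: comp_def)
  moreover have "indep_of_process P \<xi> B"
    unfolding indep_of_process_def indep_set_def
  proof (rule indep_sets_mono_sets[OF Z_indep[unfolded indep_of_process_def indep_set_def]])
    fix i :: bool
    have "sets (vimage_algebra (space P) \<xi> borel) \<subseteq> sets (vimage_algebra (space P) Z borel)"
    proof
      fix A
      assume "A \<in> sets (vimage_algebra (space P) \<xi> borel)"
      then obtain S where S: "A = \<xi> -` S \<inter> space P" "S \<in> sets borel"
        by (subst (asm) sets_vimage_algebra2) auto
      have "A = Z -` (h -` S \<inter> space borel) \<inter> space P"
        using S by (auto simp: \<xi>_def)
      moreover have "h -` S \<inter> space borel \<in> sets borel"
        using h S(2) by (rule measurable_sets)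
      ultimately show "A \<in> sets (vimage_algebra (space P) Z borel)"
        by (subst sets_vimage_algebra2) auto
    qed
    then show "case_bool (sets (vimage_algebra (space P) \<xi> borel))
        (sets (vimage_algebra (space P) (\<lambda>\<omega>. \<lambda>s\<in>{0..}. B s \<omega>) (PiM {0..} (\<lambda>_. borel)))) i
      \<subseteq> case_bool (sets (vimage_algebra (space P) Z borel))
        (sets (vimage_algebra (space P) (\<lambda>\<omega>. \<lambda>s\<in>{0..}. B s \<omega>) (PiM {0..} (\<lambda>_. borel)))) i"
      by (cases i) auto
  qed
  ultimately show thesis
    using that by blast
qed

end

section \<open>Bounds for the value function\<close>

definition control_cost :: "'w measure \<Rightarrow> (real^'n \<Rightarrow> real) \<Rightarrow> real \<Rightarrow> real \<Rightarrow> real \<Rightarrow>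
    (real \<Rightarrow> 'w \<Rightarrow> real^'n) \<Rightarrow> ('w \<Rightarrow> real^'n) \<Rightarrow> real" where
  "control_cost P V T \<epsilon> t \<alpha> \<xi> =
     (\<integral>\<omega>. (LINT s:{t..T}|lborel.
        (norm (\<alpha> s \<omega>))\<^sup>2 / 2 - V (trajectory t \<alpha> \<xi> s \<omega> /\<^sub>R \<epsilon>)) \<partial>P)"

lemma value_function_eq:
  "value_function P F B V T \<epsilon> t m =
    (INF (\<alpha>, \<xi>) \<in> admissible P F B T t m. control_cost P V T \<epsilon> t \<alpha> \<xi>)"
  by (simp add: value_function_def control_cost_def)

lemma control_cost_nonneg:
  assumes "\<And>x. V x \<le> 0"
  shows "0 \<le> control_cost P V T \<epsilon> t \<alpha> \<xi>"
proof -
  have "0 \<le> (norm (\<alpha> s \<omega>))\<^sup>2 / 2 - V (trajectory t \<alpha> \<xi> s \<omega> /\<^sub>R \<epsilon>)" for s \<omega>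
    using assms[of "trajectory t \<alpha> \<xi> s \<omega> /\<^sub>R \<epsilon>"] zero_le_power2[of "norm (\<alpha> s \<omega>)"] by linarith
  then show ?thesis
    unfolding control_cost_def set_lebesgue_integral_def
    by (intro integral_nonneg_AE always_eventually allI scaleR_nonneg_nonneg) auto
qed

lemma value_function_le:
  assumes "(\<alpha>, \<xi>) \<in> admissible P F B T t m" "\<And>x. V x \<le> 0"
  shows "value_function P F B V T \<epsilon> t m \<le> control_cost P V T \<epsilon> t \<alpha> \<xi>"
proof -
  have "bdd_below ((\<lambda>(\<alpha>, \<xi>). control_cost P V T \<epsilon> t \<alpha> \<xi>) ` admissible P F B T t m)"
    using control_cost_nonneg[of V, OF assms(2)] by (intro bdd_belowI[of _ 0]) auto
  then show ?thesis
    unfolding value_function_eq using assms(1) cINF_lower by fastforce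
qed

lemma value_function_ge:
  assumes "admissible P F B T t m \<noteq> {}"
    and "\<And>\<alpha> \<xi>. (\<alpha>, \<xi>) \<in> admissible P F B T t m \<Longrightarrow> a \<le> control_cost P V T \<epsilon> t \<alpha> \<xi>"
  shows "a \<le> value_function P F B V T \<epsilon> t m"
  unfolding value_function_eq using assms by (intro cINF_greatest) auto

section \<open>Upper bound by steering to a zero of the potential\<close>

text \<open>Each coordinate of \<open>u x\<close> is minus the fractional part of
  \<open>x $ i - z $ i\<close>, so that \<open>x + u x\<close> is an integer translate of
  \<open>z\<close>; the explicit formula makes the choice measurable.\<close>

lemma Zd_periodic_zero_near:
  fixes V :: "real^'n \<Rightarrow> real"
  assumes V: "Zd_periodic V" "V z = 0"
  obtains u :: "real^'n \<Rightarrow> real^'n" where "u \<in> borel_measurable borel"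
    "\<And>x. V (x + u x) = 0" "\<And>x. (norm (u x))\<^sup>2 \<le> CARD('n)"
proof
  define u :: "real^'n \<Rightarrow> real^'n" where
    "u x = (\<chi> i. z $ i + of_int \<lfloor>x $ i - z $ i\<rfloor> - x $ i)" for x
  have [measurable]: "(\<lambda>x::real^'n. x $ i) \<in> borel_measurable borel" for i
    by (intro borel_measurable_continuous_onI continuous_intros)
  show "u \<in> borel_measurable borel"
    unfolding u_def
    by (subst borel_measurable_euclidean_space) (auto simp: Basis_vec_def inner_axis)
  fix x
  have "x + u x = z + (\<chi> i. of_int \<lfloor>x $ i - z $ i\<rfloor>)"
    by (simp add: u_def vec_eq_iff)
  then show "V (x + u x) = 0"
    using V by (simp add: Zd_periodic_def)
  have "(norm (u x))\<^sup>2 = (\<Sum>i\<in>UNIV. (u x $ i)\<^sup>2)"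
    by (simp add: norm_vec_def L2_set_def sum_nonneg)
  also have "\<dots> \<le> (\<Sum>i\<in>(UNIV::'n set). 1)"
  proof (rule sum_mono)
    fix i
    have "\<bar>u x $ i\<bar> \<le> 1"
      unfolding u_def by (simp, linarith)
    then show "(u x $ i)\<^sup>2 \<le> 1"
      by (simp add: abs_square_le_1)
  qed
  finally show "(norm (u x))\<^sup>2 \<le> CARD('n)"
    by simp
qed

context control_space
begin

text \<open>The control uses only \<open>\<xi>\<close>, known at time \<open>t\<close>, and a
  deterministic switching time; being bounded, it has finite energy.\<close>

lemma constant_control_admissible:
  fixes v :: "real^'n \<Rightarrow> real^'n"
  assumes t: "0 \<le> t" "t \<le> T"
    and v [measurable]: "v \<in> borel_measurable borel" and K: "\<And>x. (norm (v x))\<^sup>2 \<le> K"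
    and \<xi>: "\<xi> \<in> borel_measurable (F t)" "distr P borel \<xi> = m" "indep_of_process P \<xi> B"
  shows "((\<lambda>s \<omega>. if s \<le> r then v (\<xi> \<omega>) else 0), \<xi>) \<in> admissible P F B T t m"
proof -
  have "prog_measurable_on F t T (\<lambda>s \<omega>. if s \<le> r then v (\<xi> \<omega>) else 0)"
    unfolding prog_measurable_on_def
  proof
    fix s
    assume s: "s \<in> {t..T}"
    have "subalgebra (F s) (F t)"
      using F_mono[of t s] subalgebra_F[of t] subalgebra_F[of s] s t by (auto simp: subalgebra_def)
    then have [measurable]: "\<xi> \<in> borel_measurable (F s)"
      using \<xi>(1) measurable_from_subalg by blast
    have [measurable]: "(\<lambda>\<tau>. \<tau>) \<in> borel_measurable (restrict_space borel {t..s})"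
      by (intro measurable_restrict_space1) simp
    have [measurable]: "fst \<in> borel_measurable (restrict_space borel {t..s} \<Otimes>\<^sub>M F s)"
      by (rule measurable_compose[OF measurable_fst]) measurable
    have "(\<lambda>p. if fst p \<le> r then v (\<xi> (snd p)) else 0)
        \<in> borel_measurable (restrict_space borel {t..s} \<Otimes>\<^sub>M F s)"
      by measurable
    then show "(\<lambda>(\<tau>, \<omega>). if \<tau> \<le> r then v (\<xi> \<omega>) else 0)
        \<in> borel_measurable (restrict_space borel {t..s} \<Otimes>\<^sub>M F s)"
      by (simp add: case_prod_beta)
  qed
  moreover have "(\<integral>\<^sup>+\<omega>. (\<integral>\<^sup>+s\<in>{t..T}. ennreal ((norm (if s \<le> r then v (\<xi> \<omega>) else 0))\<^sup>2) \<partial>lborel) \<partial>P) < \<infinity>"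
  proof -
    have "0 \<le> K"
      using K[of 0] zero_le_power2 order_trans by blast
    then have "(\<integral>\<^sup>+\<omega>. (\<integral>\<^sup>+s\<in>{t..T}. ennreal ((norm (if s \<le> r then v (\<xi> \<omega>) else 0))\<^sup>2) \<partial>lborel) \<partial>P)
      \<le> (\<integral>\<^sup>+\<omega>. (\<integral>\<^sup>+s\<in>{t..T}. ennreal K \<partial>lborel) \<partial>P)"
      using K by (intro nn_integral_mono) (auto intro!: mult_right_mono ennreal_leI)
    also have "\<dots> < \<infinity>"
      using t by (simp add: nn_integral_cmult_indicator ennreal_mult_less_top emeasure_space_1)
    finally show ?thesis .
  qed
  ultimately show ?thesis
    using \<xi> by (simp add: admissible_def)
qed

text \<open>The state is driven in time \<open>\<epsilon>\<close>, at speed of order 1, to a zero of \<open>V(\<cdot>/\<epsilon>)\<close>, where it stays.\<close>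

lemma value_function_bounds:
  fixes m :: "(real^'n) measure" and V :: "real^'n \<Rightarrow> real"
  assumes \<epsilon>: "0 < \<epsilon>" and t: "0 \<le> t" "t \<le> T" and m: "prob_space m" "sets m = sets borel"
    and V: "Zd_periodic V" "\<And>x. V x \<le> 0" "V z = 0" "\<And>x. - C \<le> V x"
  shows "admissible P F B T t m \<noteq> {}"
    and "0 \<le> value_function P F B V T \<epsilon> t m"
    and "value_function P F B V T \<epsilon> t m \<le> (CARD('n) / 2 + C) * \<epsilon>"
proof -
  obtain \<xi> where \<xi>: "\<xi> \<in> borel_measurable (F t)" "distr P borel \<xi> = m" "indep_of_process P \<xi> B"
    using initial_condition_ex[OF m t(1)] by blast
  obtain u :: "real^'n \<Rightarrow> real^'n" where u [measurable]: "u \<in> borel_measurable borel"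
    and Vu: "\<And>x. V (x + u x) = 0" and norm_u: "\<And>x. (norm (u x))\<^sup>2 \<le> CARD('n)"
    using Zd_periodic_zero_near[OF V(1,3)] by blast
  \<comment> \<open>In time \<epsilon> the rescaled state
    \<open>\<xi> \<omega> /\<^sub>R \<epsilon>\<close> is displaced by exactly
    \<open>u (\<xi> \<omega> /\<^sub>R \<epsilon>)\<close>.\<close>
  define v where "v x = u (x /\<^sub>R \<epsilon>)" for x
  define \<alpha> where "\<alpha> s \<omega> = (if s \<le> t + \<epsilon> then v (\<xi> \<omega>) else 0)" for s \<omega>
  have "v \<in> borel_measurable borel"
    unfolding v_def by measurable
  then have adm: "(\<alpha>, \<xi>) \<in> admissible P F B T t m"
    unfolding \<alpha>_def using norm_u by (intro constant_control_admissible[OF t _ _ \<xi>]) (auto simp: v_def)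
  then show ne: "admissible P F B T t m \<noteq> {}"
    by blast
  show "0 \<le> value_function P F B V T \<epsilon> t m"
    by (rule value_function_ge[OF ne control_cost_nonneg[OF V(2)]])
  \<comment> \<open>The running cost is at most \<open>K\<close> while moving and zero after
    arrival.\<close>
  define K where "K = CARD('n) / 2 + C"
  have K: "0 \<le> K"
    using V(4)[of z] V(3) by (simp add: K_def)
  have integrand: "(norm (\<alpha> s \<omega>))\<^sup>2 / 2 - V (trajectory t \<alpha> \<xi> s \<omega> /\<^sub>R \<epsilon>) \<le> K * indicator {t..t + \<epsilon>} s"
    if "t \<le> s" for s \<omega>
  proof (cases "s \<le> t + \<epsilon>")
    case True
    then show ?thesis
      using that norm_u[of "\<xi> \<omega> /\<^sub>R \<epsilon>"] V(4)[of "trajectory t \<alpha> \<xi> s \<omega> /\<^sub>R \<epsilon>"]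
      by (simp add: \<alpha>_def v_def K_def)
  next
    case False
    have "(LINT \<tau>:{t..s}|lborel. \<alpha> \<tau> \<omega>) = (\<integral>\<tau>. indicator {t..t + \<epsilon>} \<tau> *\<^sub>R v (\<xi> \<omega>) \<partial>lborel)"
      unfolding set_lebesgue_integral_def using False
      by (intro Bochner_Integration.integral_cong) (auto simp: \<alpha>_def indicator_def)
    also have "\<dots> = \<epsilon> *\<^sub>R v (\<xi> \<omega>)"
      using \<epsilon> by simp
    finally have "trajectory t \<alpha> \<xi> s \<omega> /\<^sub>R \<epsilon> = \<xi> \<omega> /\<^sub>R \<epsilon> + u (\<xi> \<omega> /\<^sub>R \<epsilon>)"
      using \<epsilon> by (simp add: trajectory_def scaleR_add_right v_def)
    then show ?thesis
      using False Vu by (simp add: \<alpha>_def)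
  qed
  have "(LINT s:{t..T}|lborel. (norm (\<alpha> s \<omega>))\<^sup>2 / 2 - V (trajectory t \<alpha> \<xi> s \<omega> /\<^sub>R \<epsilon>)) \<le> K * \<epsilon>" for \<omega>
  proof -
    have "(LINT s:{t..T}|lborel. (norm (\<alpha> s \<omega>))\<^sup>2 / 2 - V (trajectory t \<alpha> \<xi> s \<omega> /\<^sub>R \<epsilon>))
        \<le> (\<integral>s. K * indicator {t..t + \<epsilon>} s \<partial>lborel)"
      unfolding set_lebesgue_integral_def
    \<comment> \<open>Only the dominating function has to be integrable, and its integral is
      \<open>K * \<epsilon>\<close> even if \<open>t + \<epsilon>\<close> lies beyond
      \<open>T\<close>.\<close>
    proof (rule integral_mono')
      show "integrable lborel (\<lambda>s. K * indicator {t..t + \<epsilon>} s)"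
        using \<epsilon> by (intro integrable_mult_right integrable_real_indicator) auto
      fix s
      show "0 \<le> K * indicator {t..t + \<epsilon>} s"
        using K by simp
      then show "indicator {t..T} s *\<^sub>R ((norm (\<alpha> s \<omega>))\<^sup>2 / 2 - V (trajectory t \<alpha> \<xi> s \<omega> /\<^sub>R \<epsilon>))
          \<le> K * indicator {t..t + \<epsilon>} s"
        using integrand[of s \<omega>] by (cases "s \<in> {t..T}") simp_all
    qed
    then show ?thesis
      using \<epsilon> by simp
  qed
  then have "control_cost P V T \<epsilon> t \<alpha> \<xi> \<le> (\<integral>\<omega>. K * \<epsilon> \<partial>P)"
    unfolding control_cost_def using K \<epsilon> by (intro integral_mono') auto
  then have "control_cost P V T \<epsilon> t \<alpha> \<xi> \<le> K * \<epsilon>"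
    by (simp add: prob_space)
  then show "value_function P F B V T \<epsilon> t m \<le> (CARD('n) / 2 + C) * \<epsilon>"
    using value_function_le[where V = V and \<epsilon> = \<epsilon>, OF adm V(2)] unfolding K_def by linarith
qed

end

section \<open>Lower bound along a single path\<close>

text \<open>The two entries of the minimum belong to two cases: the path stays within
  \<open>\<epsilon> / 3\<close> of the origin for the whole unit of time, or it does not.\<close>

lemma path_cost_lower_bound:
  fixes a :: "real \<Rightarrow> real^'n" and V :: "real^'n \<Rightarrow> real"
  assumes meas: "set_borel_measurable lborel {t..t + 1} a"
    and L2: "set_integrable lborel {t..t + 1} (\<lambda>s. (norm (a s))\<^sup>2)" and \<epsilon>: "0 < \<epsilon>"
    and V: "continuous_on UNIV V" "\<And>x. V x \<le> 0" "\<And>x. x \<in> ball 0 (1/3) \<Longrightarrow> V x \<le> -1"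
  shows "min 1 (\<epsilon> / 3) \<le>
    (LINT s:{t..t + 1}|lborel. (norm (a s))\<^sup>2 / 2 - V ((LINT \<tau>:{t..s}|lborel. a \<tau>) /\<^sub>R \<epsilon>))"
proof -
  define X where "X s = (LINT \<tau>:{t..s}|lborel. a \<tau>)" for s
  define f where "f s = (norm (a s))\<^sup>2 / 2 - V (X s /\<^sub>R \<epsilon>)" for s
  have one: "set_integrable lborel {t..s} (\<lambda>_. c)" for s and c :: real
    by (intro borel_integrable_atLeastAtMost' continuous_intros)
  \<comment> \<open>\<open>norm (a s) \<le> (norm (a s))\<^sup>2 + 1\<close> turns square
    integrability into integrability, so that \<open>X\<close> is continuous and a first exit time
    makes sense.\<close>
  have a: "set_integrable lborel {t..t + 1} a"
  proof (rule set_integrable_bound[OF _ meas])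
    show "set_integrable lborel {t..t + 1} (\<lambda>s. (norm (a s))\<^sup>2 + 1)"
      using L2 one by (rule set_integral_add)
    have "norm (a s) \<le> norm ((norm (a s))\<^sup>2 + 1)" for s
      using sum_squares_bound[of "norm (a s)" 1] norm_ge_zero[of "a s"] zero_le_power2[of "norm (a s)"]
      by (simp add: abs_if)
    then show "AE s in lborel. s \<in> {t..t + 1} \<longrightarrow> norm (a s) \<le> norm ((norm (a s))\<^sup>2 + 1)"
      by simp
  qed
  have sub: "set_integrable lborel {t..s} g" if "set_integrable lborel {t..t + 1} g" "s \<le> t + 1"
    for s and g :: "real \<Rightarrow> 'c::{banach, second_countable_topology}"
    using that by (intro set_integrable_subset[OF that(1)]) auto
  have "continuous_on {t..t + 1} (\<lambda>s. integral {t..s} a)"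
    by (intro indefinite_integral_continuous_1 set_borel_integral_eq_integral a)
  then have X: "continuous_on {t..t + 1} X"
    by (rule continuous_on_eq) (auto simp: X_def set_borel_integral_eq_integral sub[OF a])
  have contV: "continuous_on {t..t + 1} (\<lambda>s. V (X s /\<^sub>R \<epsilon>))"
    by (intro continuous_on_compose2[OF V(1)] continuous_intros X) auto
  have f: "set_integrable lborel {t..t + 1} f"
    unfolding f_def
    by (intro set_integral_diff set_integrable_divide L2 borel_integrable_atLeastAtMost' contV)
  have f0: "0 \<le> f s" for s
    using V(2)[of "X s /\<^sub>R \<epsilon>"] zero_le_power2[of "norm (a s)"] unfolding f_def by linarith
  have f1: "(norm (a s))\<^sup>2 / 2 + 1 \<le> f s" if "norm (X s) < \<epsilon> / 3" for s
    using V(3)[of "X s /\<^sub>R \<epsilon>"] that \<epsilon> by (simp add: f_def field_simps)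
  show ?thesis
  proof (cases "\<forall>s\<in>{t..t + 1}. norm (X s) < \<epsilon> / 3")
    case True
    have "1 \<le> f s" if "s \<in> {t..t + 1}" for s
    proof -
      have "(norm (a s))\<^sup>2 / 2 + 1 \<le> f s"
        using True that by (intro f1) blast
      then show ?thesis
        using zero_le_power2[of "norm (a s)"] by linarith
    qed
    then have "(LINT s:{t..t + 1}|lborel. 1) \<le> (LINT s:{t..t + 1}|lborel. f s)"
      by (intro set_integral_mono one f)
    then have "1 \<le> (LINT s:{t..t + 1}|lborel. f s)"
      by (simp add: set_lebesgue_integral_def)
    then show ?thesis
      unfolding f_def X_def by simp
  next
    case False
    \<comment> \<open>\<open>S\<close> is closed because \<open>X\<close> is continuous, so its
      infimum is the first exit time from the open ball.\<close>
    define S where "S = {s \<in> {t..t + 1}. \<epsilon> / 3 \<le> norm (X s)}"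
    have "S \<noteq> {}"
      using False by (force simp: S_def)
    have "closed S"
      unfolding S_def by (intro continuous_on_closed_Collect_le continuous_intros X) auto
    moreover have "bdd_below S"
      unfolding S_def by (intro bdd_belowI[of _ t]) auto
    ultimately have "Inf S \<in> S"
      using \<open>S \<noteq> {}\<close> closed_contains_Inf by blast
    define r where "r = Inf S"
    have r: "t \<le> r" "r \<le> t + 1" "\<epsilon> / 3 \<le> norm (X r)"
      using \<open>Inf S \<in> S\<close> by (auto simp: r_def S_def)
    have before: "norm (X s) < \<epsilon> / 3" if "t \<le> s" "s < r" for s
    proof (rule ccontr)
      assume "\<not> norm (X s) < \<epsilon> / 3"
      then have "s \<in> S"
        using that r by (simp add: S_def)
      then have "r \<le> s"
        unfolding r_def using \<open>bdd_below S\<close> by (rule cInf_lower)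
      with that show False
        by simp
    qed
    have speed: "norm (a s) \<le> f s" if "t \<le> s" "s < r" for s
    proof -
      have "norm (a s) \<le> (norm (a s))\<^sup>2 / 2 + 1"
        using sum_squares_bound[of "norm (a s)" 1] by simp
      then show ?thesis
        using f1[OF before[OF that]] by linarith
    qed
    \<comment> \<open>At \<open>r\<close> itself the path is on or outside the sphere and the bound
      may fail; a single time is a null set.\<close>
    have "AE s\<in>{t..r} in lborel. norm (a s) \<le> f s"
      using AE_lborel_singleton[of r] by eventually_elim (auto intro: speed)
    then have "(LINT s:{t..r}|lborel. norm (a s)) \<le> (LINT s:{t..r}|lborel. f s)"
      using sub[OF a r(2)] sub[OF f r(2)] by (intro set_integral_mono_AE set_integrable_norm)
    \<comment> \<open>\<open>f\<close> is nonnegative, so the cost after the exit can be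
      added.\<close>
    also have "\<dots> \<le> (LINT s:{t..t + 1}|lborel. f s)"
      using f sub[OF f r(2)] f0 r unfolding set_lebesgue_integral_def set_integrable_def
      by (intro integral_mono) (auto simp: indicator_def)
    finally have "norm (X r) \<le> (LINT s:{t..t + 1}|lborel. f s)"
      using set_integral_norm_bound[OF sub[OF a r(2)]] unfolding X_def by linarith
    then show ?thesis
      using r(3) unfolding f_def X_def by linarith
  qed
qed

section \<open>Lower bound in expectation\<close>

context control_space
begin

text \<open>A positive lower bound on an expectation needs true integrability, since the integral of
  a non-integrable function is 0 by convention. The energy of the control plus
  \<open>C * (T - t)\<close> dominates the cost; most of the work is joint measurability.\<close>

lemma control_cost_integrable:
  fixes V :: "real^'n \<Rightarrow> real"
  assumes adm: "(\<alpha>, \<xi>) \<in> admissible P F B T t m" and t: "0 \<le> t" "t \<le> T"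
    and V: "continuous_on UNIV V" "\<And>x. V x \<le> 0" "\<And>x. - C \<le> V x"
  shows "integrable P (\<lambda>\<omega>. LINT s:{t..T}|lborel.
      (norm (\<alpha> s \<omega>))\<^sup>2 / 2 - V (trajectory t \<alpha> \<xi> s \<omega> /\<^sub>R \<epsilon>))" (is ?int)
    and "AE \<omega> in P. set_borel_measurable lborel {t..T} (\<lambda>s. \<alpha> s \<omega>) \<and>
      set_integrable lborel {t..T} (\<lambda>s. (norm (\<alpha> s \<omega>))\<^sup>2)" (is ?ae)
proof -
  \<comment> \<open>Progressive measurability speaks of times in \<open>{t..T}\<close> only.
    Clamping the time and cutting off by the indicator yields a jointly measurable process on the
    whole line that agrees with \<open>\<alpha>\<close> on \<open>{t..T}\<close>.\<close>
  define a where "a s \<omega> = indicator {t..T} s *\<^sub>R \<alpha> (max t (min T s)) \<omega>" for s \<omega>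
  have [measurable]: "V \<in> borel_measurable borel"
    by (intro borel_measurable_continuous_onI V)
  have "subalgebra P (F T)" "subalgebra P (F t)"
    using t by (auto intro!: subalgebra_F)
  moreover have "\<xi> \<in> borel_measurable (F t)"
    using adm by (simp add: admissible_def)
  ultimately have [measurable]: "\<xi> \<in> borel_measurable P" and id: "(\<lambda>\<omega>. \<omega>) \<in> measurable P (F T)"
    using measurable_from_subalg[of P "F t"] by (auto simp: subalgebra_def measurable_def)
  have \<alpha>: "(\<lambda>(\<tau>, \<omega>). \<alpha> \<tau> \<omega>) \<in> borel_measurable (restrict_space borel {t..T} \<Otimes>\<^sub>M F T)"
    using adm t by (simp add: admissible_def prog_measurable_on_def)
  have clamp: "(\<lambda>p. (max t (min T (fst p)), snd p))
      \<in> measurable (borel \<Otimes>\<^sub>M P) (restrict_space borel {t..T} \<Otimes>\<^sub>M F T)"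
  proof (rule measurable_Pair)
    show "(\<lambda>p. max t (min T (fst p))) \<in> measurable (borel \<Otimes>\<^sub>M P) (restrict_space borel {t..T})"
      using t by (intro measurable_restrict_space2) auto
    show "(\<lambda>p. snd p) \<in> measurable (borel \<Otimes>\<^sub>M P) (F T)"
      by (rule measurable_compose[OF measurable_snd id])
  qed
  have "(\<lambda>p. \<alpha> (max t (min T (fst p))) (snd p)) \<in> borel_measurable (borel \<Otimes>\<^sub>M P)"
    using measurable_compose[OF clamp \<alpha>] by simp
  then have a_meas [measurable]: "(\<lambda>p. a (fst p) (snd p)) \<in> borel_measurable (borel \<Otimes>\<^sub>M P)"
    unfolding a_def by measurable
  have a_eq: "a s \<omega> = \<alpha> s \<omega>" if "s \<in> {t..T}" for s \<omega>
  proof -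
    have "max t (min T s) = s"
      using that by auto
    then show ?thesis
      using that by (simp add: a_def)
  qed
  have a_out: "a s \<omega> = 0" if "s \<notin> {t..T}" for s \<omega>
    using that by (simp add: a_def)
  have ind: "indicator A s *\<^sub>R \<alpha> s \<omega> = indicator A s *\<^sub>R a s \<omega>" if "A \<subseteq> {t..T}" for A s \<omega>
    using that a_eq by (cases "s \<in> A") auto
  have a_sec [measurable]: "(\<lambda>s. a s \<omega>) \<in> borel_measurable borel" if "\<omega> \<in> space P" for \<omega>
    using that measurable_compose[OF measurable_Pair2' a_meas, of \<omega>] by simp
  \<comment> \<open>The cost rewritten with \<open>a\<close>; the inner integral runs over the whole
    line with \<open>s\<close> as a parameter, so that measurability of parameter integrals applies
    in \<open>(\<omega>, s)\<close>.\<close>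
  define f where "f s \<omega> = indicator {t..T} s *\<^sub>R
      ((norm (a s \<omega>))\<^sup>2 / 2 - V ((\<xi> \<omega> + (\<integral>\<tau>. (if t \<le> \<tau> \<and> \<tau> \<le> s then a \<tau> \<omega> else 0) \<partial>lborel)) /\<^sub>R \<epsilon>))" for s \<omega>
  have f_eq: "f s \<omega> = indicator {t..T} s *\<^sub>R ((norm (\<alpha> s \<omega>))\<^sup>2 / 2 - V (trajectory t \<alpha> \<xi> s \<omega> /\<^sub>R \<epsilon>))" for s \<omega>
  proof (cases "s \<in> {t..T}")
    case True
    then have "a s \<omega> = \<alpha> s \<omega>"
      by (rule a_eq)
    moreover have "(if t \<le> \<tau> \<and> \<tau> \<le> s then a \<tau> \<omega> else 0) = indicator {t..s} \<tau> *\<^sub>R \<alpha> \<tau> \<omega>" for \<tau>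
      using True by (subst ind) (auto simp: indicator_def)
    ultimately show ?thesis
      using True by (simp add: f_def trajectory_def set_lebesgue_integral_def)
  qed (simp add: f_def)
  have inner: "(\<lambda>p. \<integral>\<tau>. (if t \<le> \<tau> \<and> \<tau> \<le> snd p then a \<tau> (fst p) else 0) \<partial>lborel)
      \<in> borel_measurable (P \<Otimes>\<^sub>M borel)"
  proof (rule lborel.borel_measurable_lebesgue_integral)
    have [measurable]: "(\<lambda>q. a (snd q) (fst (fst q))) \<in> borel_measurable ((P \<Otimes>\<^sub>M borel) \<Otimes>\<^sub>M lborel)"
      using measurable_compose[OF _ a_meas, of "\<lambda>q. (snd q, fst (fst q))" "(P \<Otimes>\<^sub>M borel) \<Otimes>\<^sub>M lborel"]
      by simp
    show "(\<lambda>(p, \<tau>). if t \<le> \<tau> \<and> \<tau> \<le> snd p then a \<tau> (fst p) else 0)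
        \<in> borel_measurable ((P \<Otimes>\<^sub>M borel) \<Otimes>\<^sub>M lborel)"
      unfolding case_prod_beta by measurable
  qed
  have f_meas: "(\<lambda>(\<omega>, s). f s \<omega>) \<in> borel_measurable (P \<Otimes>\<^sub>M lborel)"
  proof -
    have [measurable]: "(\<lambda>p. a (snd p) (fst p)) \<in> borel_measurable (P \<Otimes>\<^sub>M borel)"
      using measurable_compose[OF _ a_meas, of "\<lambda>q. (snd q, fst q)" "P \<Otimes>\<^sub>M borel"] by simp
    note [measurable] = inner
    have "(\<lambda>(\<omega>, s). f s \<omega>) \<in> borel_measurable (P \<Otimes>\<^sub>M borel)"
      unfolding f_def case_prod_beta by measurable
    then show ?thesis
      by (simp cong: measurable_cong_sets add: measurable_lborel2)
  qed
  have cost_eq: "(LINT s:{t..T}|lborel. (norm (\<alpha> s \<omega>))\<^sup>2 / 2 - V (trajectory t \<alpha> \<xi> s \<omega> /\<^sub>R \<epsilon>))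
      = (\<integral>s. f s \<omega> \<partial>lborel)" for \<omega>
    unfolding set_lebesgue_integral_def f_eq ..
  let ?E = "\<lambda>\<omega>. \<integral>\<^sup>+s\<in>{t..T}. ennreal ((norm (\<alpha> s \<omega>))\<^sup>2) \<partial>lborel"
  have E_eq: "?E \<omega> = (\<integral>\<^sup>+s. ennreal ((norm (a s \<omega>))\<^sup>2) \<partial>lborel)" for \<omega>
    by (intro nn_integral_cong) (simp add: indicator_def a_eq a_out)
  have E_fin: "(\<integral>\<^sup>+\<omega>. ?E \<omega> \<partial>P) < \<infinity>"
    using adm by (simp add: admissible_def)
  have E_meas [measurable]: "?E \<in> borel_measurable P"
  proof -
    have [measurable]: "(\<lambda>p. a (snd p) (fst p)) \<in> borel_measurable (P \<Otimes>\<^sub>M lborel)"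
      using measurable_compose[OF _ a_meas, of "\<lambda>q. (snd q, fst q)" "P \<Otimes>\<^sub>M lborel"] by simp
    show ?thesis
      unfolding E_eq by (intro lborel.borel_measurable_nn_integral) (simp add: case_prod_beta)
  qed
  have C: "0 \<le> C"
    using V(2,3) order_trans by (metis neg_0_le_iff_le neg_le_iff_le minus_minus)
  show ?int
    unfolding cost_eq
  proof (rule integrableI_bounded)
    show "(\<lambda>\<omega>. \<integral>s. f s \<omega> \<partial>lborel) \<in> borel_measurable P"
      by (rule lborel.borel_measurable_lebesgue_integral[OF f_meas])
    have "ennreal (norm (\<integral>s. f s \<omega> \<partial>lborel)) \<le> ?E \<omega> + ennreal (C * (T - t))"
      if \<omega>: "\<omega> \<in> space P" for \<omega>
    proof (cases "integrable lborel (\<lambda>s. f s \<omega>)")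
      case True
      note [measurable] = a_sec[OF \<omega>]
      have bound: "ennreal (norm (f s \<omega>)) \<le> ennreal ((norm (a s \<omega>))\<^sup>2) + ennreal C * indicator {t..T} s" for s
      proof (cases "s \<in> {t..T}")
        case True
        then have "a s \<omega> = \<alpha> s \<omega>"
          by (rule a_eq)
        moreover have "norm (f s \<omega>) \<le> (norm (\<alpha> s \<omega>))\<^sup>2 + C"
        proof -
          have le: "\<bar>x / 2 - y\<bar> \<le> x + C" if "0 \<le> x" "y \<le> 0" "- C \<le> y" for x y :: real
            using that by linarith
          have "norm (f s \<omega>) = \<bar>(norm (\<alpha> s \<omega>))\<^sup>2 / 2 - V (trajectory t \<alpha> \<xi> s \<omega> /\<^sub>R \<epsilon>)\<bar>"
            using True by (simp add: f_eq)
          also have "\<dots> \<le> (norm (\<alpha> s \<omega>))\<^sup>2 + C"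
            by (intro le V zero_le_power2)
          finally show ?thesis .
        qed
        ultimately show ?thesis
          using True C by (simp flip: ennreal_plus add: ennreal_leI)
      qed (simp add: f_eq)
      have "ennreal (norm (\<integral>s. f s \<omega> \<partial>lborel)) \<le> (\<integral>\<^sup>+s. norm (f s \<omega>) \<partial>lborel)"
        by (rule integral_norm_bound_ennreal[OF True])
      also have "\<dots> \<le> (\<integral>\<^sup>+s. ennreal ((norm (a s \<omega>))\<^sup>2) + ennreal C * indicator {t..T} s \<partial>lborel)"
        by (intro nn_integral_mono bound)
      also have "\<dots> = ?E \<omega> + ennreal (C * (T - t))"
        using t C by (subst nn_integral_add)
          (auto simp: E_eq nn_integral_cmult_indicator ennreal_mult)
      finally show ?thesis .
    \<comment> \<open>If \<open>f\<close> is not integrable in \<open>s\<close>, the left side is 0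
      by convention.\<close>
    qed (simp add: not_integrable_integral_eq)
    then have "(\<integral>\<^sup>+\<omega>. ennreal (norm (\<integral>s. f s \<omega> \<partial>lborel)) \<partial>P) \<le> (\<integral>\<^sup>+\<omega>. ?E \<omega> + ennreal (C * (T - t)) \<partial>P)"
      by (intro nn_integral_mono)
    also have "\<dots> = (\<integral>\<^sup>+\<omega>. ?E \<omega> \<partial>P) + ennreal (C * (T - t))"
      by (subst nn_integral_add) (auto simp: emeasure_space_1)
    also have "\<dots> < \<infinity>"
      using E_fin by simp
    finally show "(\<integral>\<^sup>+\<omega>. ennreal (norm (\<integral>s. f s \<omega> \<partial>lborel)) \<partial>P) < \<infinity>" .
  qed
  \<comment> \<open>Finite expected energy makes the energy of almost every path finite.\<close>
  have "AE \<omega> in P. ?E \<omega> \<noteq> \<infinity>"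
    using E_fin by (intro nn_integral_PInf_AE) auto
  then show ?ae
    using AE_space
  proof eventually_elim
    case (elim \<omega>)
    note [measurable] = a_sec[OF elim(2)]
    have "indicator {t..T} s *\<^sub>R (norm (\<alpha> s \<omega>))\<^sup>2 = (norm (a s \<omega>))\<^sup>2" for s
      by (simp add: indicator_def a_eq a_out)
    moreover have "integrable lborel (\<lambda>s. (norm (a s \<omega>))\<^sup>2)"
      using elim(1) unfolding E_eq by (intro integrableI_bounded) (auto simp: top.not_eq_extremum)
    moreover have "(\<lambda>s. indicator {t..T} s *\<^sub>R \<alpha> s \<omega>) \<in> borel_measurable lborel"
      by (subst ind) auto
    ultimately show ?case
      by (simp add: set_borel_measurable_def set_integrable_def)
  qed
qed

text \<open>Under the Dirac law almost every path starts at the origin, and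
  \<open>{T - 1..T}\<close> is one unit of time, so the bound for single paths applies and can be
  integrated.\<close>

lemma control_cost_lower_bound:
  fixes V :: "real^'n \<Rightarrow> real"
  assumes adm: "(\<alpha>, \<xi>) \<in> admissible P F B T (T - 1) (return borel 0)" and T: "1 \<le> T" and \<epsilon>: "0 < \<epsilon>"
    and V: "continuous_on UNIV V" "\<And>x. V x \<le> 0" "\<And>x. - C \<le> V x"
      "\<And>x. x \<in> ball 0 (1/3) \<Longrightarrow> V x \<le> -1"
  shows "min 1 (\<epsilon> / 3) \<le> control_cost P V T \<epsilon> (T - 1) \<alpha> \<xi>"
proof -
  let ?t = "T - 1"
  have t: "0 \<le> ?t" "?t \<le> T"
    using T by auto
  have "\<xi> \<in> borel_measurable (F ?t)" and law: "distr P borel \<xi> = return borel 0"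
    using adm by (auto simp: admissible_def)
  then have \<xi>: "\<xi> \<in> borel_measurable P"
    using measurable_from_subalg[OF subalgebra_F[OF t(1)]] by blast
  have "AE x in return borel (0::real^'n). x = 0"
    by (subst AE_return) auto
  then have "AE \<omega> in P. \<xi> \<omega> = 0"
    unfolding law[symmetric] using \<xi> by (subst (asm) AE_distr_iff) auto
  then have "AE \<omega> in P. min 1 (\<epsilon> / 3) \<le> (LINT s:{?t..T}|lborel.
      (norm (\<alpha> s \<omega>))\<^sup>2 / 2 - V (trajectory ?t \<alpha> \<xi> s \<omega> /\<^sub>R \<epsilon>))"
    using control_cost_integrable(2)[OF adm t V(1-3)]
  proof eventually_elim
    case (elim \<omega>)
    then show ?case
      using path_cost_lower_bound[of ?t "\<lambda>s. \<alpha> s \<omega>" \<epsilon> V] \<epsilon> V by (simp add: trajectory_def)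
  qed
  then have "(\<integral>\<omega>. min 1 (\<epsilon> / 3) \<partial>P) \<le> control_cost P V T \<epsilon> ?t \<alpha> \<xi>"
    unfolding control_cost_def
    by (intro integral_mono_AE control_cost_integrable(1)[OF adm t V(1-3)]) auto
  then show ?thesis
    by (simp add: prob_space)
qed

end

theorem proposition5p5:
  fixes T :: real
    and V :: "real^'n \<Rightarrow> real"
    and H :: "real^'n \<Rightarrow> real^'n \<Rightarrow> real"
    and G :: "(real^'n) measure \<Rightarrow> real"
    and U :: "real \<Rightarrow> (real^'n) measure \<Rightarrow> real"
    and U\<epsilon> :: "real \<Rightarrow> real \<Rightarrow> (real^'n) measure \<Rightarrow> real"
    and N :: "'a measure"
    and R :: "'h::real_inner \<Rightarrow> 'a \<Rightarrow> real^'n"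
    and P :: "'w measure"
    and F :: "real \<Rightarrow> 'w measure"
    and B :: "real \<Rightarrow> 'w \<Rightarrow> real^'n"
    and Z :: "'w \<Rightarrow> real^'n"
  assumes T: "T \<ge> 1"
    and H_def: "\<And>x p. H x p = (norm p)\<^sup>2 / 2 + V x"
    and V_periodic: "Zd_periodic V"
    and V_continuous: "continuous_on UNIV V"
    and V_max: "\<And>x. V x \<le> 0" "\<exists>x. V x = 0"
    and V_ball: "\<And>x. x \<in> ball 0 (1/3) \<Longrightarrow> V x \<le> -1"
    and G_zero: "\<And>m. m \<in> P2 \<Longrightarrow> G m = 0"
    and N: "atomless_prob_space N" "is_L2 N R"
    and P: "control_space P F B Z"
    and U\<epsilon>_solution: "\<And>\<epsilon>. \<epsilon> > 0 \<Longrightarrow>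
          L_viscosity_solution N R T (\<lambda>x p. H (x /\<^sub>R \<epsilon>) p) G (U\<epsilon> \<epsilon>)"
    and U\<epsilon>_value: "\<And>\<epsilon> t m. \<epsilon> > 0 \<Longrightarrow> t \<in> {0..T} \<Longrightarrow> m \<in> P2 \<Longrightarrow>
          U\<epsilon> \<epsilon> t m = value_function P F B V T \<epsilon> t m"
    and U_solution: "L_viscosity_solution N R T (\<lambda>x p. effective_hamiltonian H p) G U"
    and U_unique: "\<And>W t m. L_viscosity_solution N R T (\<lambda>x p. effective_hamiltonian H p) G W \<Longrightarrow>
          t \<in> {0..T} \<Longrightarrow> m \<in> P2 \<Longrightarrow> W t m = U t m"
  shows "(\<forall>t\<in>{0..T}. \<forall>m\<in>P2. U t m = 0) \<and>
         uniform_limit ({0..T} \<times> P2) (\<lambda>\<epsilon> (t, m). U\<epsilon> \<epsilon> t m) (\<lambda>(t, m). U t m) (at_right 0) \<and>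
         (\<forall>\<epsilon>. 0 < \<epsilon> \<and> \<epsilon> \<le> 6 \<longrightarrow> U\<epsilon> \<epsilon> (T - 1) (return borel 0) \<ge> \<epsilon> / 6)"
proof -
  interpret N: atomless_prob_space N by (rule N)
  interpret control_space P F B Z by (rule P)
  obtain C where C: "C > 0" "\<And>x. - C \<le> V x"
    using Zd_periodic_bounded_below[OF V_periodic V_continuous] by blast
  obtain z where z: "V z = 0"
    using V_max(2) by blast
  have "effective_hamiltonian H 0 = 0"
    by (rule effective_hamiltonian_zero[OF V_periodic V_continuous V_max H_def])
  then have "L_viscosity_solution N R T (\<lambda>x p. effective_hamiltonian H p) G (\<lambda>t m. 0)"
    using N(2) G_zero by (intro L_viscosity_solution_zero N.prob_space_axioms)
  \<comment> \<open>The zero function solves the limit equation, and uniqueness identifies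
    \<open>U\<close> with it.\<close>
  then have U: "U t m = 0" if "t \<in> {0..T}" "m \<in> P2" for t m
    using U_unique[OF _ that] by metis
  \<comment> \<open>The constant of the upper bound depends neither on \<open>t\<close> nor on
    \<open>m\<close>, which gives the uniformity.\<close>
  define K where "K = CARD('n) / 2 + C"
  have K: "0 < K"
    using C(1) by (simp add: K_def add_nonneg_pos)
  have bounds: "0 \<le> U\<epsilon> \<epsilon> t m" "U\<epsilon> \<epsilon> t m \<le> K * \<epsilon>" and ne: "admissible P F B T t m \<noteq> {}"
    if "0 < \<epsilon>" "t \<in> {0..T}" "m \<in> P2" for \<epsilon> t m
    using value_function_bounds[OF \<open>0 < \<epsilon>\<close> _ _ _ _ V_periodic V_max(1) z C(2), of t T m] that
    by (auto simp: U\<epsilon>_value P2_def K_def)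
  have "uniform_limit ({0..T} \<times> P2) (\<lambda>\<epsilon> (t, m). U\<epsilon> \<epsilon> t m) (\<lambda>(t, m). U t m) (at_right 0)"
  proof (rule uniform_limitI)
    fix e :: real
    assume "0 < e"
    have "\<forall>\<^sub>F \<epsilon> in at_right 0. \<epsilon> \<in> {0<..<e / K}"
      using \<open>0 < e\<close> K by (intro eventually_at_right_real) simp
    then show "\<forall>\<^sub>F \<epsilon> in at_right 0. \<forall>x\<in>{0..T} \<times> P2.
        dist (case x of (t, m) \<Rightarrow> U\<epsilon> \<epsilon> t m) (case x of (t, m) \<Rightarrow> U t m) < e"
    proof eventually_elim
      case (elim \<epsilon>)
      then have \<epsilon>: "0 < \<epsilon>" "K * \<epsilon> < e"
        using K by (auto simp: field_simps)
      have "dist (U\<epsilon> \<epsilon> t m) (U t m) < e" if "t \<in> {0..T}" "m \<in> P2" for t m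
        using bounds[OF \<epsilon>(1) that] \<epsilon>(2) U[OF that] by (simp add: dist_real_def)
      then show ?case
        by auto
    qed
  qed
  moreover have "\<epsilon> / 6 \<le> U\<epsilon> \<epsilon> (T - 1) (return borel 0)" if \<epsilon>: "0 < \<epsilon>" "\<epsilon> \<le> 6" for \<epsilon>
  proof -
    have "prob_space (return borel (0::real^'n))"
      by (rule prob_space_return) simp
    then have m: "return borel (0::real^'n) \<in> P2"
      by (auto simp: P2_def nn_integral_return intro!: integrableI_bounded)
    have t: "T - 1 \<in> {0..T}"
      using T by simp
    have "min 1 (\<epsilon> / 3) \<le> value_function P F B V T \<epsilon> (T - 1) (return borel 0)"
      by (rule value_function_ge[OF ne[OF \<epsilon>(1) t m]
        control_cost_lower_bound[OF _ T \<epsilon>(1) V_continuous V_max(1) C(2) V_ball]])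
    \<comment> \<open>The entry 1 of the minimum is where \<open>\<epsilon> \<le> 6\<close> enters.
      Some cap is inevitable: the zero control from the origin costs \<open>- V 0\<close> whatever
      \<epsilon> is.\<close>
    moreover have "\<epsilon> / 6 \<le> min 1 (\<epsilon> / 3)"
      using \<epsilon> by simp
    ultimately show ?thesis
      using U\<epsilon>_value[OF \<epsilon>(1) t m] by linarith
  qed
  ultimately show ?thesis
    using U by blast
qed

end
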